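(* Let $P$ be a finite nontrivial poset of size $n$ that is a direct sum of chains. Then the second-largest eigenvalue $\lambda_2(P)$ of $M_P$ satisfies $$\lambda_2(P)\le\left(1+\frac1n\right)\left(1-\frac2n\right),$$ with equality if and only if $P$ is disconnected. Furthermore, all eigenvalues of $M_P$ are non-negative.
   Context: Let $P$ be a finite poset of size $n$ with order $\preceq$, whose elements are labeled by $[n]=\{1,\dots,n\}$. A linear extension of $P$ is a permutation $\pi=\pi_1\cdots\pi_n\in S_n$ such that $\pi_i\prec\pi_j$ in $P$ implies $i<j$; $\mathcal L(P)$ is the set of all linear extensions. For $\pi\in\mathcal L(P)$ and $1\le i\le n-1$, let $\pi\cdot\tau_i$ be the linear extension obtained from $\pi$ by interchanging the entries at positions $i$ and $i+1$ if $\pi_i$ and $\pi_{i+1}$ are incomparable in $P$, and $\pi\cdot\tau_i=\pi$ otherwise. Operators act on the right, so in a product the leftmost operator is applied first. For $i,j\in[n]$ set $T_{i,j}=\tau_i\tau_{i+1}\cdots\tau_{j-1}$ if $i\le j$ (the identity if $i=j$) and $T_{i,j}=\tau_{i-1}\tau_{i-2}\cdots\tau_j$ if $i>j$. The $P$-random-to-random shuffle is the Markov chain on $\mathcal L(P)$ with transition matrix $$M_P(\pi,\pi')=\frac1{n^2}\left|\{(i,j)\in[n]\times[n] \mid \pi'=\pi\cdot T_{i,j}\}\right|.$$ A poset is trivial if it is a chain, and nontrivial otherwise. It is disconnected if its Hasse diagram is a disconnected graph. A direct sum of chains is a disjoint union of (nonempty) chains, with elements of different chains incomparable. The matrix $M_P$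 is real symmetric and stochastic with largest eigenvalue $1$; $\lambda_2(P)$ denotes its second-largest eigenvalue (counted with multiplicity). *)

theory Defs
  imports
    "HOL-Library.Disjoint_Sets"
    "HOL-Combinatorics.Permutations"
    "HOL-Computational_Algebra.Polynomial"
    "Graph_Theory.Digraph_Component"
    "Graph_Theory.Pair_Digraph"
    "Jordan_Normal_Form.Char_Poly"
begin

text \<open>
  A poset of size \<open>n\<close> labeled by \<open>[n]\<close> is a relation \<open>r\<close> with
  \<open>partial_order_on {1..n} r\<close>, where \<open>(x, y) \<in> r\<close> means \<open>x \<preceq> y\<close>.
  A word \<open>\<pi>\<^sub>1 \<dots> \<pi>\<^sub>n\<close> in \<open>S\<^sub>n\<close> is a function
  with \<open>\<pi> permutes {1..n}\<close>, whose entry at position \<open>i\<close> is \<open>\<pi> i\<close>.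
\<close>

definition strictly_below :: "nat rel \<Rightarrow> nat \<Rightarrow> nat \<Rightarrow> bool" where
  "strictly_below r x y \<longleftrightarrow> (x, y) \<in> r \<and> x \<noteq> y"

definition incomparable :: "nat rel \<Rightarrow> nat \<Rightarrow> nat \<Rightarrow> bool" where
  "incomparable r x y \<longleftrightarrow> (x, y) \<notin> r \<and> (y, x) \<notin> r"

definition nontrivial_poset :: "nat \<Rightarrow> nat rel \<Rightarrow> bool" where
  "nontrivial_poset n r \<longleftrightarrow> \<not> total_on {1..n} r"

definition direct_sum_of_chains :: "nat \<Rightarrow> nat rel \<Rightarrow> bool" where
  "direct_sum_of_chains n r \<longleftrightarrow>
     (\<exists>\<C>. partition_on {1..n} \<C> \<and> (\<forall>C\<in>\<C>. total_on C r) \<and>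
        (\<forall>C\<in>\<C>. \<forall>D\<in>\<C>. C \<noteq> D \<longrightarrow> (\<forall>x\<in>C. \<forall>y\<in>D. incomparable r x y)))"

text \<open>
  The arcs of the Hasse diagram are the cover relations, directed upwards; the library's
  \<open>connected\<close> refers to the underlying undirected graph.
\<close>

definition hasse_diagram :: "nat \<Rightarrow> nat rel \<Rightarrow> nat pair_pre_digraph" where
  "hasse_diagram n r = \<lparr> pverts = {1..n},
     parcs = {(x, y). x \<in> {1..n} \<and> y \<in> {1..n} \<and> strictly_below r x y \<and>
       \<not> (\<exists>z\<in>{1..n}. strictly_below r x z \<and> strictly_below r z y)} \<rparr>"

definition disconnected_poset :: "nat \<Rightarrow> nat rel \<Rightarrow> bool" where
  "disconnected_poset n r \<longleftrightarrow> \<not> Digraph_Component.connected (with_proj (hasse_diagram n r))"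

definition linear_extensions :: "nat \<Rightarrow> nat rel \<Rightarrow> (nat \<Rightarrow> nat) set" where
  "linear_extensions n r = {\<pi>. \<pi> permutes {1..n} \<and>
     (\<forall>i\<in>{1..n}. \<forall>j\<in>{1..n}. strictly_below r (\<pi> i) (\<pi> j) \<longrightarrow> i < j)}"

definition tau :: "nat rel \<Rightarrow> nat \<Rightarrow> (nat \<Rightarrow> nat) \<Rightarrow> (nat \<Rightarrow> nat)" where
  "tau r i \<pi> =
     (if incomparable r (\<pi> i) (\<pi> (i + 1)) then \<pi> \<circ> transpose i (i + 1) else \<pi>)"

text \<open>
  The right action of \<open>T\<^sub>i\<^sub>,\<^sub>j\<close> on \<open>\<pi>\<close>: \<open>fold\<close> applies the head of the list first, so
  the operators are \<open>\<tau>\<^sub>i, \<dots>, \<tau>\<^sub>j\<^sub>-\<^sub>1\<close>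
  in this order if \<open>i \<le> j\<close>, and \<open>\<tau>\<^sub>i\<^sub>-\<^sub>1, \<dots>, \<tau>\<^sub>j\<close> otherwise.
\<close>

definition T_op :: "nat rel \<Rightarrow> nat \<Rightarrow> nat \<Rightarrow> (nat \<Rightarrow> nat) \<Rightarrow> (nat \<Rightarrow> nat)" where
  "T_op r i j \<pi> =
     (if i \<le> j then fold (tau r) [i..<j] \<pi> else fold (tau r) (rev [j..<i]) \<pi>)"

definition rtr_prob :: "nat \<Rightarrow> nat rel \<Rightarrow> (nat \<Rightarrow> nat) \<Rightarrow> (nat \<Rightarrow> nat) \<Rightarrow> real" where
  "rtr_prob n r \<pi> \<pi>' =
     real (card {(i, j). i \<in> {1..n} \<and> j \<in> {1..n} \<and> \<pi>' = T_op r i j \<pi>}) / (real n)\<^sup>2"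

text \<open>
  Library matrices are indexed by numbers, so \<open>M\<^sub>P\<close> is formed with respect to a list \<open>ls\<close>
  enumerating the linear extensions without repetition.
\<close>

definition rtr_matrix :: "nat \<Rightarrow> nat rel \<Rightarrow> (nat \<Rightarrow> nat) list \<Rightarrow> real mat" where
  "rtr_matrix n r ls =
     mat (length ls) (length ls) (\<lambda>(a, b). rtr_prob n r (ls ! a) (ls ! b))"

text \<open>
  The second-largest real eigenvalue, counted with (algebraic) multiplicity. It is meaningful
  only if the characteristic polynomial has at least two real roots, as is the case for
  symmetric matrices of dimension at least two.
\<close>

definition second_largest_eigenvalue :: "real mat \<Rightarrow> real" where
  "second_largest_eigenvalue A = rev (sorted_list_of_multiset (proots (char_poly A))) ! 1"

end

theory Submission
  imports Defs "HOL-Analysis.Function_Topology"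
begin

text \<open>
  Label every element of a direct sum of chains by its chain. A linear extension is determined by
  the word of labels read along it, because the order within a chain is forced
  (\<open>word_inj\<close>). On words the operator \<open>\<tau>\<^sub>i\<close> simply exchanges the letters at positions \<open>i\<close> and
  \<open>i + 1\<close>: if these are equal nothing happens, as it should for comparable elements. Hence
  \<open>T\<^sub>i\<^sub>,\<^sub>j\<close> moves the letter at position \<open>i\<close> to position \<open>j\<close>, and \<open>n\<^sup>2 M\<^sub>P\<close> becomes the operator
  \<open>R\<^sub>n\<close> that sums a function over all \<open>n\<^sup>2\<close> such moves.

  Let \<open>D\<^sub>n\<close> sum over the moves of the last letter to an arbitrary position. Its adjoint sums
  over the moves of an arbitrary letter to the last position, and \<open>R\<^sub>n = D\<^sub>n\<^sup>* D\<^sub>n\<close>. So \<open>R\<^sub>n\<close> is positive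
  semidefinite, which gives the last claim.

  The upper bound rests on the relation \<open>D\<^sub>n R\<^sub>n = (n + J\<^sub>n + R\<^sub>n\<^sub>-\<^sub>1) D\<^sub>n\<close>, where
  \<open>J\<^sub>n = (1 n) + \<dots> + (n-1 n)\<close> is the Jucys-Murphy element (\<open>last_to_random_intertwines\<close>). Let \<open>x\<close> be an
  eigenvector of \<open>R\<^sub>n\<close> orthogonal to the \<open>S\<^sub>n\<close>-invariant functions, with eigenvalue
  \<open>\<epsilon> \<noteq> 0\<close>; the bound to be proved is nonnegative for \<open>n \<ge> 2\<close>. Then \<open>D\<^sub>n x\<close> is a nonzero
  eigenvector of \<open>J\<^sub>n + R\<^sub>n\<^sub>-\<^sub>1\<close> for \<open>\<epsilon> - n\<close>, and it is orthogonal to the \<open>S\<^sub>n\<^sub>-\<^sub>1\<close>-invariant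
  functions. As \<open>J\<^sub>n\<close> commutes with \<open>R\<^sub>n\<^sub>-\<^sub>1\<close>, the same holds for some eigenvector \<open>z\<close> of \<open>J\<^sub>n\<close>.
  If \<open>J\<^sub>n z = b z\<close>, then \<open>R\<^sub>n\<^sub>-\<^sub>1 z = (\<epsilon> - n - b) z\<close>. By induction
  \<open>\<epsilon> - n - b \<le> (n-1)\<^sup>2 - (n-1) - 2\<close>, and \<open>b \<le> n - 2\<close>, because \<open>J\<^sub>n\<close> has no
  eigenvalue above \<open>n - 2\<close> except \<open>n - 1\<close> on the \<open>S\<^sub>n\<close>-invariant functions
  (\<open>jucys_murphy_gap\<close>). Adding up, \<open>\<epsilon> \<le> n\<^sup>2 - n - 2 = (n + 1) (n - 2)\<close>
  (\<open>random_to_random_gap\<close>).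

  The words form one orbit of \<open>S\<^sub>n\<close>, so only constants are invariant, and they carry the
  eigenvalue \<open>1\<close> of \<open>M\<^sub>P\<close>. The value \<open>(n + 1) (n - 2)\<close> is attained by the sum of the positions, measured from
  the centre \<open>(n + 1) / 2\<close>, of the letters of one chain (\<open>random_to_random_letter_position\<close>); this
  function is nonzero as soon as there are two chains. A nontrivial direct sum of chains has two
  chains, hence is disconnected and attains the bound: both sides of the
  stated equivalence always hold.
\<close>


section \<open>Moving one letter of a word\<close>

text \<open>
  The word \<open>w \<circ> cyc i j\<close> arises from \<open>w\<close> by moving the letter at position \<open>i\<close> to position \<open>j\<close>
  and shifting the letters in between.
\<close>

definition cyc :: "nat \<Rightarrow> nat \<Rightarrow> nat \<Rightarrow> nat" where
  "cyc i j k = (if k = j then i else if i \<le> k \<and> k < j then k + 1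
     else if j < k \<and> k \<le> i then k - 1 else k)"

text \<open>
  The case distinction is stated as a disjunction of linear constraints on the value, so that
  identities between products of such cycles and transpositions can be left to linear arithmetic.
\<close>

lemma cyc_cases:
  "k = j \<and> cyc i j k = i \<or> i \<le> k \<and> k < j \<and> cyc i j k = k + 1 \<or>
   j < k \<and> k \<le> i \<and> cyc i j k + 1 = k \<or> k < i \<and> k < j \<and> cyc i j k = k \<or>
   i < k \<and> j < k \<and> cyc i j k = k"
  by (cases "k < j"; cases "k = j"; cases "i \<le> k"; cases "i = k") (simp_all add: cyc_def)

lemma transpose_cases:
  "k = a \<and> transpose a b k = b \<or> k = b \<and> transpose a b k = a \<or> k \<noteq> a \<and> k \<noteq> b \<and> transpose a b k = k"
  by (auto simp: transpose_def)

lemma cyc_self [simp]: "cyc i i = id"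
  by (auto simp: cyc_def fun_eq_iff)

lemma cyc_comp:
  assumes "i \<in> {1..m}" "j \<in> {1..m}" shows "cyc i m \<circ> cyc m j = cyc i j"
proof
  fix x
  have "1 \<le> i" "1 \<le> j" "i \<le> m" "j \<le> m" using assms by auto
  then have "cyc i m (cyc m j x) = cyc i j x"
    using cyc_cases[of x j m] cyc_cases[of "cyc m j x" m i] cyc_cases[of x j i]
    by (elim disjE conjE; linarith)
  then show "(cyc i m \<circ> cyc m j) x = cyc i j x" by simp
qed

lemma cyc_inverse: "cyc i j \<circ> cyc j i = id"
proof
  fix x
  have "cyc i j (cyc j i x) = x"
    using cyc_cases[of x i j] cyc_cases[of "cyc j i x" j i]
    by (elim disjE conjE; linarith)
  then show "(cyc i j \<circ> cyc j i) x = id x" by simp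
qed

lemma cyc_permutes:
  assumes "i \<in> {1..m}" "j \<in> {1..m}" shows "cyc i j permutes {1..m}"
proof -
  have "bij (cyc i j)"
    using cyc_inverse[of i j] cyc_inverse[of j i] by (intro o_bij[of "cyc j i"]) auto
  moreover have "cyc i j x = x" if "x \<notin> {1..m}" for x
    using that assms by (auto simp: cyc_def)
  ultimately show ?thesis by (auto simp: permutes_def bij_iff)
qed

lemma cyc_Suc:
  "i \<le> m \<Longrightarrow> cyc i (Suc m) = cyc i m \<circ> transpose m (Suc m)"
  "j \<le> m \<Longrightarrow> cyc (Suc m) j = transpose m (Suc m) \<circ> cyc m j"
proof -
  show "cyc i (Suc m) = cyc i m \<circ> transpose m (Suc m)" if "i \<le> m"
  proof
    fix x
    have "cyc i (Suc m) x = cyc i m (transpose m (Suc m) x)"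
      using that cyc_cases[of x "Suc m" i] transpose_cases[of x m "Suc m"]
        cyc_cases[of "transpose m (Suc m) x" m i]
      by (elim disjE conjE; linarith)
    then show "cyc i (Suc m) x = (cyc i m \<circ> transpose m (Suc m)) x" by simp
  qed
  show "cyc (Suc m) j = transpose m (Suc m) \<circ> cyc m j" if "j \<le> m"
  proof
    fix x
    have "cyc (Suc m) j x = transpose m (Suc m) (cyc m j x)"
      using that cyc_cases[of x j "Suc m"] cyc_cases[of x j m]
        transpose_cases[of "cyc m j x" m "Suc m"]
      by (elim disjE conjE; linarith)
    then show "cyc (Suc m) j x = (transpose m (Suc m) \<circ> cyc m j) x" by simp
  qed
qed

text \<open>
  Insert the letters at positions \<open>m\<close> and \<open>m + 1\<close> at prescribed places. The same word results when
  the two letters are taken in the other order, with one of the places adjusted.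
\<close>

lemma cyc_insert_twice:
  assumes "1 \<le> j" "j \<le> l" "l \<le> m"
  shows "transpose m (Suc m) \<circ> cyc m l \<circ> cyc (Suc m) j = cyc m j \<circ> cyc (Suc m) (Suc l)"
proof
  fix x
  have "cyc (Suc m) l (cyc (Suc m) j x) = cyc m j (cyc (Suc m) (Suc l) x)"
  proof -
    consider "x < j" | "x = j" | "j < x" "x \<le> l" | "x = Suc l" | "Suc l < x" "x \<le> Suc m" | "Suc m < x"
      by linarith
    then show ?thesis
      using assms by cases (auto simp: cyc_def)
  qed
  then show "(transpose m (Suc m) \<circ> cyc m l \<circ> cyc (Suc m) j) x = (cyc m j \<circ> cyc (Suc m) (Suc l)) x"
    using assms by (simp add: cyc_Suc)
qed

text \<open>
  Inserting the last letter and then taking a letter from the left of the new place to the end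
  amounts to removing the latter first, trading it for the last letter, and inserting that.
\<close>

lemma cyc_insert_remove_above:
  assumes "1 \<le> i" "i \<le> j" "j \<le> m"
  shows "cyc (Suc m) (Suc j) \<circ> cyc i (Suc m) = cyc i m \<circ> transpose m (Suc m) \<circ> cyc m j"
proof
  fix x
  have cancel: "cyc a b (cyc b a x) = x" for a b x
    using cyc_inverse[of a b] by (metis comp_apply id_apply)
  have "cyc m i (cyc (Suc m) (Suc j) (cyc i (Suc m) x)) = cyc (Suc m) j x"
    using fun_cong[OF cyc_insert_twice[OF assms], of "cyc i (Suc m) x"] assms by (simp add: cyc_Suc cancel)
  then have "cyc (Suc m) (Suc j) (cyc i (Suc m) x) = cyc i m (cyc (Suc m) j x)"
    by (metis cancel)
  then show "(cyc (Suc m) (Suc j) \<circ> cyc i (Suc m)) x = (cyc i m \<circ> transpose m (Suc m) \<circ> cyc m j) x"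
    using assms by (simp add: cyc_Suc)
qed

text \<open>
  Taking inverses in the previous identity exchanges the two roles and gives the case of
  a letter to the right of the new place.
\<close>

lemma cyc_insert_remove_below:
  assumes "1 \<le> i" "i \<le> j" "j \<le> m"
  shows "cyc (Suc m) i \<circ> cyc (Suc j) (Suc m) = cyc j m \<circ> transpose m (Suc m) \<circ> cyc m i"
proof -
  let ?s = "transpose m (Suc m)"
  let ?L = "cyc (Suc m) i \<circ> cyc (Suc j) (Suc m)" and ?R = "cyc j m \<circ> ?s \<circ> cyc m i"
  let ?M = "cyc i m \<circ> ?s \<circ> cyc m j"
  have M: "?M = cyc (Suc m) (Suc j) \<circ> cyc i (Suc m)"
    using cyc_insert_remove_above[OF assms] by simp
  have cancel: "cyc a b (cyc b a x) = x" for a b x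
    using cyc_inverse[of a b] by (metis comp_apply id_apply)
  have "?M (?R x) = x" for x
    by (simp add: cancel)
  moreover have "?L (?M x) = x" for x
    unfolding M by (simp add: cancel)
  ultimately have "?L x = ?R x" for x
    by metis
  then show ?thesis by blast
qed

lemma cyc_transpose:
  assumes "1 \<le> k" "k \<le> m"
  shows "cyc k m \<circ> transpose m (Suc m) \<circ> cyc m k = transpose k (Suc m)"
proof
  fix x
  have "cyc k m (transpose m (Suc m) (cyc m k x)) = cyc k (Suc m) (cyc m k x)"
    using assms by (simp add: cyc_Suc)
  also have "\<dots> = transpose k (Suc m) x"
    using assms cyc_cases[of x k m] cyc_cases[of "cyc m k x" "Suc m" k] transpose_cases[of x k "Suc m"]
    by (elim disjE conjE; linarith)
  finally show "(cyc k m \<circ> transpose m (Suc m) \<circ> cyc m k) x = transpose k (Suc m) x" by simp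
qed

lemma transpose_cyc_above:
  assumes "Suc k < i" "i \<le> n"
  shows "transpose k (Suc k) \<circ> cyc i n = cyc i n \<circ> transpose k (Suc k)"
proof
  fix x
  have "transpose k (Suc k) (cyc i n x) = cyc i n (transpose k (Suc k) x)"
  proof -
    consider "x < k" | "x = k" | "x = Suc k" | "Suc k < x" "x < i" | "i \<le> x" "x < n" | "x = n" | "n < x"
      by linarith
    then show ?thesis
      using assms by cases (simp_all add: cyc_def transpose_def)
  qed
  then show "(transpose k (Suc k) \<circ> cyc i n) x = (cyc i n \<circ> transpose k (Suc k)) x" by simp
qed

lemma transpose_cyc_below:
  assumes "i \<le> k" "Suc k < n"
  shows "transpose (Suc k) (Suc (Suc k)) \<circ> cyc i n = cyc i n \<circ> transpose k (Suc k)"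
proof
  fix x
  have "transpose (Suc k) (Suc (Suc k)) (cyc i n x) = cyc i n (transpose k (Suc k) x)"
  proof -
    consider "x < i" | "i \<le> x" "x < k" | "x = k" | "x = Suc k" | "Suc k < x" "x < n" | "x = n" | "n < x"
      by linarith
    then show ?thesis
      using assms by cases (simp_all add: cyc_def transpose_def)
  qed
  then show "(transpose (Suc k) (Suc (Suc k)) \<circ> cyc i n) x = (cyc i n \<circ> transpose k (Suc k)) x" by simp
qed

lemma transpose_cyc_at:
  assumes "k < n"
  shows "transpose k (Suc k) \<circ> cyc k n = cyc (Suc k) n"
    "transpose k (Suc k) \<circ> cyc (Suc k) n = cyc k n"
proof -
  show 1: "transpose k (Suc k) \<circ> cyc k n = cyc (Suc k) n"
  proof
    fix x
    have "transpose k (Suc k) (cyc k n x) = cyc (Suc k) n x"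
      using assms cyc_cases[of x n k] transpose_cases[of "cyc k n x" k "Suc k"] cyc_cases[of x n "Suc k"]
      by (elim disjE conjE; linarith)
    then show "(transpose k (Suc k) \<circ> cyc k n) x = cyc (Suc k) n x" by simp
  qed
  show "transpose k (Suc k) \<circ> cyc (Suc k) n = cyc k n"
    unfolding 1[symmetric] by (simp flip: o_assoc add: fun_eq_iff)
qed

section \<open>Operators on functions of words\<close>

definition last_to_random :: "nat \<Rightarrow> ((nat \<Rightarrow> 'a) \<Rightarrow> real) \<Rightarrow> (nat \<Rightarrow> 'a) \<Rightarrow> real" where
  "last_to_random m f = (\<lambda>w. \<Sum>j\<in>{1..m}. f (w \<circ> cyc m j))"

definition random_to_last :: "nat \<Rightarrow> ((nat \<Rightarrow> 'a) \<Rightarrow> real) \<Rightarrow> (nat \<Rightarrow> 'a) \<Rightarrow> real" where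
  "random_to_last m f = (\<lambda>w. \<Sum>i\<in>{1..m}. f (w \<circ> cyc i m))"

definition random_to_random :: "nat \<Rightarrow> ((nat \<Rightarrow> 'a) \<Rightarrow> real) \<Rightarrow> (nat \<Rightarrow> 'a) \<Rightarrow> real" where
  "random_to_random m f = (\<lambda>w. \<Sum>i\<in>{1..m}. \<Sum>j\<in>{1..m}. f (w \<circ> cyc i j))"

definition jucys_murphy :: "nat \<Rightarrow> ((nat \<Rightarrow> 'a) \<Rightarrow> real) \<Rightarrow> (nat \<Rightarrow> 'a) \<Rightarrow> real" where
  "jucys_murphy m f = (\<lambda>w. \<Sum>i\<in>{1..<m}. f (w \<circ> transpose i m))"

definition swap :: "nat \<Rightarrow> ((nat \<Rightarrow> 'a) \<Rightarrow> real) \<Rightarrow> (nat \<Rightarrow> 'a) \<Rightarrow> real" where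
  "swap k f = (\<lambda>w. f (w \<circ> transpose k (Suc k)))"

text \<open>
  Every move passes through the last position: the letter is first sent there and then inserted.
\<close>

lemma random_to_random_factor:
  "random_to_random m f = random_to_last m (last_to_random m f)"
  unfolding random_to_random_def random_to_last_def last_to_random_def
  by (intro ext sum.cong refl) (simp add: o_assoc[symmetric] cyc_comp)

lemma sum_square_Suc:
  fixes h :: "nat \<Rightarrow> nat \<Rightarrow> real"
  shows "(\<Sum>j\<in>{1..Suc m}. \<Sum>i\<in>{1..Suc m}. h j i)
    = (\<Sum>j\<in>{1..m}. \<Sum>i\<in>{1..m}. h j i) + (\<Sum>i\<in>{1..m}. h (Suc m) i) + (\<Sum>i\<in>{1..m}. h i (Suc m))
      + h (Suc m) (Suc m)"
  by (simp add: sum.distrib)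

text \<open>
  Deleting the diagonal of a square with side \<open>m + 1\<close> leaves two triangles with \<open>m (m + 1) / 2\<close>
  cells each. They cover the square with side \<open>m\<close> in such a way that its diagonal is covered twice.
\<close>

lemma sum_square_off_diagonal:
  fixes h g :: "nat \<Rightarrow> nat \<Rightarrow> real"
  assumes "\<And>j. j \<in> {1..Suc m} \<Longrightarrow> h j j = c"
    and "\<And>i j. 1 \<le> i \<Longrightarrow> i \<le> j \<Longrightarrow> j \<le> m \<Longrightarrow> h (Suc j) i = g i j"
    and "\<And>i j. 1 \<le> i \<Longrightarrow> i \<le> j \<Longrightarrow> j \<le> m \<Longrightarrow> h i (Suc j) = g j i"
  shows "(\<Sum>j\<in>{1..Suc m}. \<Sum>i\<in>{1..Suc m}. h j i)
    = real (Suc m) * c + (\<Sum>k\<in>{1..m}. g k k) + (\<Sum>k\<in>{1..m}. \<Sum>l\<in>{1..m}. g k l)"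
  using assms
proof (induction m)
  case 0
  then show ?case by simp
next
  case (Suc m)
  have IH: "(\<Sum>j\<in>{1..Suc m}. \<Sum>i\<in>{1..Suc m}. h j i)
    = real (Suc m) * c + (\<Sum>k\<in>{1..m}. g k k) + (\<Sum>k\<in>{1..m}. \<Sum>l\<in>{1..m}. g k l)"
    by (rule Suc.IH) (use Suc.prems in auto)
  have "(\<Sum>i\<in>{1..Suc m}. h (Suc (Suc m)) i) = (\<Sum>i\<in>{1..Suc m}. g i (Suc m))"
    by (intro sum.cong refl Suc.prems) auto
  moreover have "(\<Sum>i\<in>{1..Suc m}. h i (Suc (Suc m))) = (\<Sum>i\<in>{1..Suc m}. g (Suc m) i)"
    by (intro sum.cong refl Suc.prems) auto
  moreover have "h (Suc (Suc m)) (Suc (Suc m)) = c"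
    using Suc.prems by simp
  ultimately show ?case
    unfolding sum_square_Suc[of _ "Suc m"] IH unfolding sum_square_Suc
    by (simp add: algebra_simps)
qed

text \<open>
  Insert the last letter at position \<open>j\<close>, then take the letter at position \<open>i\<close> to the end. For
  \<open>i = j\<close> nothing changes. Otherwise some earlier letter becomes the last one, after a removal and an
  insertion among the first \<open>m\<close> positions; the insertion at the very place of the removal is counted
  twice, and the surplus is a transposition with the last letter.
\<close>

lemma last_to_random_random_to_last:
  "last_to_random (Suc m) (random_to_last (Suc m) f) w =
     real (Suc m) * f w + jucys_murphy (Suc m) f w
     + (\<Sum>k\<in>{1..m}. \<Sum>l\<in>{1..m}. f (w \<circ> cyc k m \<circ> transpose m (Suc m) \<circ> cyc m l))"
proof -
  let ?g = "\<lambda>k l. f (w \<circ> (cyc k m \<circ> transpose m (Suc m) \<circ> cyc m l))"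
  have "last_to_random (Suc m) (random_to_last (Suc m) f) w =
    (\<Sum>j\<in>{1..Suc m}. \<Sum>i\<in>{1..Suc m}. f (w \<circ> (cyc (Suc m) j \<circ> cyc i (Suc m))))"
    unfolding last_to_random_def random_to_last_def by (simp only: o_assoc)
  also have "\<dots> = real (Suc m) * f w + (\<Sum>k\<in>{1..m}. ?g k k) + (\<Sum>k\<in>{1..m}. \<Sum>l\<in>{1..m}. ?g k l)"
    by (rule sum_square_off_diagonal)
      (simp_all only: cyc_inverse cyc_insert_remove_above cyc_insert_remove_below o_id comp_id)
  also have "(\<Sum>k\<in>{1..m}. ?g k k) = jucys_murphy (Suc m) f w"
    unfolding jucys_murphy_def
    by (intro sum.cong) (auto simp: atLeastLessThanSuc_atLeastAtMost cyc_transpose simp del: o_apply)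
  finally show ?thesis by (simp only: o_assoc)
qed

text \<open>
  The cells of an \<open>m\<close> by \<open>m + 1\<close> rectangle on and below the diagonal are exchanged with those above
  it.
\<close>

lemma sum_rectangle_swap:
  fixes F G :: "nat \<Rightarrow> nat \<Rightarrow> real"
  assumes "\<And>j l. 1 \<le> j \<Longrightarrow> j \<le> l \<Longrightarrow> l \<le> m \<Longrightarrow> F l j = G j (Suc l)"
    and "\<And>j l. 1 \<le> j \<Longrightarrow> j \<le> l \<Longrightarrow> l \<le> m \<Longrightarrow> F j (Suc l) = G l j"
  shows "(\<Sum>l\<in>{1..m}. \<Sum>j\<in>{1..Suc m}. F l j) = (\<Sum>l\<in>{1..m}. \<Sum>j\<in>{1..Suc m}. G l j)"
  using assms
proof (induction m)
  case 0
  then show ?case by simp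
next
  case (Suc m)
  have IH: "(\<Sum>l\<in>{1..m}. \<Sum>j\<in>{1..Suc m}. F l j) = (\<Sum>l\<in>{1..m}. \<Sum>j\<in>{1..Suc m}. G l j)"
    by (rule Suc.IH) (use Suc.prems in auto)
  have split: "(\<Sum>l\<in>{1..Suc m}. \<Sum>j\<in>{1..Suc (Suc m)}. H l j) =
    (\<Sum>l\<in>{1..m}. \<Sum>j\<in>{1..Suc m}. H l j) + (\<Sum>j\<in>{1..Suc m}. H (Suc m) j)
    + (\<Sum>l\<in>{1..Suc m}. H l (Suc (Suc m)))" for H :: "nat \<Rightarrow> nat \<Rightarrow> real"
    by (simp add: sum.distrib)
  have "(\<Sum>j\<in>{1..Suc m}. F (Suc m) j) = (\<Sum>l\<in>{1..Suc m}. G l (Suc (Suc m)))"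
    by (intro sum.cong refl Suc.prems) auto
  moreover have "(\<Sum>l\<in>{1..Suc m}. F l (Suc (Suc m))) = (\<Sum>j\<in>{1..Suc m}. G (Suc m) j)"
    by (intro sum.cong refl Suc.prems) auto
  ultimately show ?case
    unfolding split IH by (simp only: add_ac)
qed

text \<open>
  When the last two letters are both inserted at random, it does not matter which one goes first.
\<close>

lemma swap_last_to_random_twice:
  "swap m (last_to_random m (last_to_random (Suc m) f)) = last_to_random m (last_to_random (Suc m) f)"
proof
  fix w
  let ?s = "transpose m (Suc m)"
  have insert_twice': "?s \<circ> cyc m j \<circ> cyc (Suc m) (Suc l) = cyc m l \<circ> cyc (Suc m) j"
    if "1 \<le> j" "j \<le> l" "l \<le> m" for j l
  proof -
    have "?s \<circ> cyc m j \<circ> cyc (Suc m) (Suc l) = ?s \<circ> (?s \<circ> cyc m l \<circ> cyc (Suc m) j)"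
      using cyc_insert_twice[OF that] by (simp only: o_assoc)
    then show ?thesis by (simp add: fun_eq_iff)
  qed
  have "(\<Sum>l\<in>{1..m}. \<Sum>j\<in>{1..Suc m}. f (w \<circ> (?s \<circ> cyc m l \<circ> cyc (Suc m) j)))
     = (\<Sum>l\<in>{1..m}. \<Sum>j\<in>{1..Suc m}. f (w \<circ> (cyc m l \<circ> cyc (Suc m) j)))"
    by (rule sum_rectangle_swap) (simp_all only: cyc_insert_twice insert_twice')
  then show "swap m (last_to_random m (last_to_random (Suc m) f)) w
      = last_to_random m (last_to_random (Suc m) f) w"
    unfolding swap_def last_to_random_def by (simp only: o_assoc)
qed

text \<open>
  This is the recursion behind the eigenvalue bound. In \<open>D D\<^sup>* D\<close> the product \<open>D D\<^sup>*\<close> is expanded; in the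
  double sum the exchange of the last two positions is absorbed by the invariance of two successive
  insertions, and what remains is the shuffle of the first \<open>m\<close> positions.
\<close>

lemma last_to_random_intertwines:
  "last_to_random (Suc m) (random_to_random (Suc m) f) w =
     real (Suc m) * last_to_random (Suc m) f w
     + jucys_murphy (Suc m) (last_to_random (Suc m) f) w
     + random_to_random m (last_to_random (Suc m) f) w"
proof -
  let ?g = "last_to_random (Suc m) f"
  have "(\<Sum>k\<in>{1..m}. \<Sum>l\<in>{1..m}. ?g (w \<circ> cyc k m \<circ> transpose m (Suc m) \<circ> cyc m l))
     = (\<Sum>k\<in>{1..m}. swap m (last_to_random m ?g) (w \<circ> cyc k m))"
    unfolding swap_def last_to_random_def[of m] by (rule refl)
  also have "\<dots> = random_to_random m ?g w"
    unfolding swap_last_to_random_twice random_to_random_factor by (simp add: random_to_last_def)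
  finally show ?thesis
    unfolding random_to_random_factor[of "Suc m"] last_to_random_random_to_last by simp
qed

text \<open>
  A permutation of the first \<open>m\<close> positions only permutes the transpositions that make up the
  Jucys-Murphy element.
\<close>

lemma jucys_murphy_act:
  assumes "\<sigma> permutes {1..m}"
  shows "jucys_murphy (Suc m) (\<lambda>w. f (w \<circ> \<sigma>)) w = jucys_murphy (Suc m) f (w \<circ> \<sigma>)"
proof -
  have fixed: "\<sigma> (Suc m) = Suc m"
    using assms by (simp add: permutes_not_in)
  have "\<sigma> \<circ> transpose i (Suc m) = transpose (\<sigma> i) (Suc m) \<circ> \<sigma>" for i
  proof
    fix x
    have "\<sigma> x = Suc m \<longleftrightarrow> x = Suc m"
      using permutes_inj[OF assms] fixed by (metis injD)
    then show "(\<sigma> \<circ> transpose i (Suc m)) x = (transpose (\<sigma> i) (Suc m) \<circ> \<sigma>) x"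
      using permutes_inj[OF assms] fixed by (simp add: transpose_def inj_eq)
  qed
  then have "jucys_murphy (Suc m) f (w \<circ> \<sigma>) = (\<Sum>i\<in>{1..m}. f (w \<circ> (transpose (\<sigma> i) (Suc m) \<circ> \<sigma>)))"
    unfolding jucys_murphy_def by (simp only: o_assoc[symmetric] atLeastLessThanSuc_atLeastAtMost)
  also have "\<dots> = (\<Sum>i\<in>{1..m}. f (w \<circ> (transpose i (Suc m) \<circ> \<sigma>)))"
    by (rule sum.reindex_bij_betw) (rule permutes_imp_bij[OF assms])
  finally show ?thesis
    unfolding jucys_murphy_def by (simp only: o_assoc atLeastLessThanSuc_atLeastAtMost)
qed

lemma jucys_murphy_sum:
  "jucys_murphy m (\<lambda>w. \<Sum>i\<in>I. f i w) w = (\<Sum>i\<in>I. jucys_murphy m (f i) w)"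
  unfolding jucys_murphy_def by (rule sum.swap)

lemma jucys_murphy_random_to_random:
  "jucys_murphy (Suc m) (random_to_random m f) = random_to_random m (jucys_murphy (Suc m) f)"
  unfolding random_to_random_def
  by (intro ext, simp only: jucys_murphy_sum) (intro sum.cong refl jucys_murphy_act cyc_permutes)

lemma jucys_murphy_commute:
  "jucys_murphy (Suc m) (jucys_murphy m f) = jucys_murphy m (jucys_murphy (Suc m) f)"
proof
  fix w
  show "jucys_murphy (Suc m) (jucys_murphy m f) w = jucys_murphy m (jucys_murphy (Suc m) f) w"
    unfolding jucys_murphy_def[of m]
    by (simp add: jucys_murphy_sum jucys_murphy_act permutes_swap_id)
qed

text \<open>
  The degenerate affine Hecke relation \<open>s J\<^sub>m s + s = J\<^sub>m\<^sub>+\<^sub>1\<close> for \<open>s = (m m+1)\<close>, multiplied by \<open>s\<close>.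
\<close>

lemma jucys_murphy_swap:
  "m \<ge> 1 \<Longrightarrow> jucys_murphy m (swap m f) w = swap m (jucys_murphy (Suc m) f) w - f w"
proof -
  assume "m \<ge> 1"
  have "transpose i m \<circ> transpose m (Suc m) = transpose m (Suc m) \<circ> transpose i (Suc m)" if "i < m" for i
    using that by (auto simp: fun_eq_iff transpose_def)
  then have "jucys_murphy m (swap m f) w = (\<Sum>i\<in>{1..<m}. f (w \<circ> (transpose m (Suc m) \<circ> transpose i (Suc m))))"
    unfolding jucys_murphy_def swap_def by (intro sum.cong refl) (simp add: o_assoc[symmetric])
  moreover have "w \<circ> transpose m (Suc m) \<circ> transpose m (Suc m) = w"
    by (simp add: fun_eq_iff)
  ultimately show ?thesis
    using \<open>m \<ge> 1\<close> by (simp add: jucys_murphy_def swap_def o_assoc)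
qed


lemma jucys_murphy_lin:
  "jucys_murphy m (\<lambda>w. a * f w + b * g w) = (\<lambda>w. a * jucys_murphy m f w + b * jucys_murphy m g w)"
  by (simp add: jucys_murphy_def sum.distrib sum_distrib_left)

lemma random_to_random_lin:
  "random_to_random m (\<lambda>w. a * f w + b * g w) =
    (\<lambda>w. a * random_to_random m f w + b * random_to_random m g w)"
  by (simp add: random_to_random_def sum.distrib sum_distrib_left)

lemma jucys_murphy_continuous: "continuous_on UNIV (\<lambda>f. jucys_murphy m f w)"
  unfolding jucys_murphy_def by (intro continuous_intros continuous_on_product_coordinates)

lemma random_to_random_continuous: "continuous_on UNIV (\<lambda>f. random_to_random m f w)"
  unfolding random_to_random_def by (intro continuous_intros continuous_on_product_coordinates)

text \<open>
  Invariance under \<open>S\<^sub>m\<close> is expressed through the generating adjacent transpositions, so that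
  passing from \<open>m\<close> to \<open>m + 1\<close> adds a single condition.
\<close>

definition symmetric_under :: "nat \<Rightarrow> ((nat \<Rightarrow> 'a) \<Rightarrow> real) \<Rightarrow> bool" where
  "symmetric_under m f \<longleftrightarrow> (\<forall>k. 1 \<le> k \<and> k < m \<longrightarrow> swap k f = f)"

lemma symmetric_under_Suc:
  "m \<ge> 1 \<Longrightarrow> symmetric_under (Suc m) f \<longleftrightarrow> symmetric_under m f \<and> swap m f = f"
  unfolding symmetric_under_def by (auto simp: less_Suc_eq)

text \<open>
  The cycles taking position \<open>i\<close> to the end are representatives of the cosets of \<open>S\<^sub>m\<close> in \<open>S\<^sub>m\<^sub>+\<^sub>1\<close>, so
  an adjacent transposition permutes the summands up to elements of \<open>S\<^sub>m\<close>.
\<close>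

lemma symmetric_under_random_to_last:
  assumes g: "symmetric_under m g"
  shows "symmetric_under (Suc m) (random_to_last (Suc m) g)"
  unfolding symmetric_under_def
proof (intro allI impI ext)
  fix k w assume k: "1 \<le> k \<and> k < Suc m"
  let ?s = "transpose k (Suc k)" and ?n = "Suc m"
  have g': "g (u \<circ> transpose l (Suc l)) = g u" if "1 \<le> l" "l < m" for l u
    using g that by (auto simp: symmetric_under_def swap_def fun_eq_iff)
  have "g (w \<circ> (?s \<circ> cyc i ?n)) = g (w \<circ> cyc (?s i) ?n)" if i: "i \<in> {1..?n}" for i
  proof -
    consider "i = k" | "i = Suc k" | "Suc k < i" | "i < k" by linarith
    then show ?thesis
    proof cases
      case 1
      then show ?thesis using k transpose_cyc_at(1)[of k ?n] by simp
    next
      case 2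
      then show ?thesis using k transpose_cyc_at(2)[of k ?n] by simp
    next
      case 3
      then have "g (w \<circ> (?s \<circ> cyc i ?n)) = g (w \<circ> cyc i ?n \<circ> ?s)"
        using transpose_cyc_above[of k i ?n] i by (simp add: o_assoc)
      then show ?thesis
        using 3 g'[of k "w \<circ> cyc i ?n"] i k by (simp add: transpose_def)
    next
      case 4
      obtain l where l: "k = Suc l" using k by (cases k) auto
      have "g (w \<circ> (?s \<circ> cyc i ?n)) = g (w \<circ> cyc i ?n \<circ> transpose l (Suc l))"
        using transpose_cyc_below[of i l ?n] i k 4 l by (simp add: o_assoc)
      then show ?thesis
        using 4 g'[of l "w \<circ> cyc i ?n"] i k l by (simp add: transpose_def)
    qed
  qed
  then have "swap k (random_to_last ?n g) w = (\<Sum>i\<in>{1..?n}. g (w \<circ> cyc (?s i) ?n))"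
    unfolding swap_def random_to_last_def
    by (intro sum.cong refl) (simp add: o_assoc del: o_apply)
  also have "\<dots> = (\<Sum>i\<in>{1..?n}. g (w \<circ> cyc i ?n))"
    by (rule sum.reindex_bij_betw) (use k in \<open>simp add: permutes_imp_bij permutes_swap_id\<close>)
  finally show "swap k (random_to_last ?n g) w = random_to_last ?n g w"
    by (simp add: random_to_last_def)
qed

lemma symmetric_under_jucys_murphy:
  assumes "symmetric_under m g"
  shows "symmetric_under m (jucys_murphy (Suc m) g)"
  unfolding symmetric_under_def
proof (intro allI impI ext)
  fix k w assume k: "1 \<le> k \<and> k < m"
  then have "swap k g = g" using assms by (auto simp: symmetric_under_def)
  moreover have "transpose k (Suc k) permutes {1..m}" using k by (simp add: permutes_swap_id)
  from jucys_murphy_act[OF this, of g w]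
  have "swap k (jucys_murphy (Suc m) g) w = jucys_murphy (Suc m) (swap k g) w"
    by (simp add: swap_def)
  ultimately show "swap k (jucys_murphy (Suc m) g) w = jucys_murphy (Suc m) g w" by simp
qed


section \<open>Eigenvectors of symmetric operators\<close>

text \<open>
  A Rayleigh quotient argument: on the unit sphere of an invariant subspace, which is
  compact because the functions live on a finite set, the quadratic form of a symmetric operator has
  a maximum, and it is attained at an eigenvector. Functions on an arbitrary type that vanish
  outside a finite set serve as the vectors, with the product topology, so closedness and continuity
  can be checked coordinate by coordinate.
\<close>

lemma symmetric_operator_eigenvector:
  fixes A :: "('a \<Rightarrow> real) \<Rightarrow> 'a \<Rightarrow> real"
  assumes X: "finite X" and U: "closed U"
    and supp: "\<And>f w. f \<in> U \<Longrightarrow> w \<notin> X \<Longrightarrow> f w = 0"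
    and subspace: "\<And>f g a b. f \<in> U \<Longrightarrow> g \<in> U \<Longrightarrow> (\<lambda>w. a * f w + b * g w) \<in> U"
    and inv: "\<And>f. f \<in> U \<Longrightarrow> A f \<in> U"
    and lin: "\<And>f g a b. A (\<lambda>w. a * f w + b * g w) = (\<lambda>w. a * A f w + b * A g w)"
    and sym: "\<And>f g. (\<Sum>w\<in>X. A f w * g w) = (\<Sum>w\<in>X. f w * A g w)"
    and cont: "\<And>w. continuous_on UNIV (\<lambda>f. A f w)"
    and y: "y \<in> U" "y \<noteq> (\<lambda>_. 0)"
  obtains z b where "z \<in> U" "z \<noteq> (\<lambda>_. 0)" "A z = (\<lambda>w. b * z w)"
proof -
  let ?ip = "\<lambda>f g. \<Sum>w\<in>X. f w * g w :: real"
  have pos: "?ip f f > 0" if f: "f \<in> U" "f \<noteq> (\<lambda>_. 0)" for f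
  proof -
    obtain w where "f w \<noteq> 0" using f(2) by auto
    moreover from this have "w \<in> X" using supp[OF f(1)] by auto
    moreover from \<open>f w \<noteq> 0\<close> have "0 < f w * f w"
      by (metis not_real_square_gt_zero)
    ultimately show ?thesis using X by (intro sum_pos2[of X w]) auto
  qed
  define S where "S = {f \<in> U. ?ip f f = 1}"
  let ?B = "Pi\<^sub>E UNIV (\<lambda>w. if w \<in> X then {-1..1::real} else {0})"
  have cipf: "continuous_on UNIV (\<lambda>f. ?ip f f)"
    by (intro continuous_intros continuous_on_product_coordinates)
  have "compact ?B"
  proof -
    have "compactin (product_topology (\<lambda>_. euclidean) UNIV) ?B"
      by (simp add: compactin_PiE)
    then show ?thesis
      by (simp add: euclidean_product_topology)
  qed
  moreover have "closed S"
    unfolding S_def using U cipf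
    by (intro closed_Collect_conj closed_Collect_eq) (auto intro: continuous_intros)
  moreover have "S \<subseteq> ?B"
  proof
    fix f assume f: "f \<in> S"
    have "\<bar>f w\<bar> \<le> 1" if "w \<in> X" for w
    proof -
      have "(f w)\<^sup>2 \<le> ?ip f f"
        using X that by (subst power2_eq_square) (intro member_le_sum, auto)
      then have "(f w)\<^sup>2 \<le> 1" using f by (simp add: S_def)
      then show ?thesis by (simp add: abs_square_le_1)
    qed
    then show "f \<in> ?B"
      using f supp[of f] by (auto simp: S_def abs_le_iff)
  qed
  ultimately have compact_S: "compact S"
    by (metis compact_Int_closed inf.absorb_iff2)
  have normalize: "(\<lambda>w. (1 / sqrt (?ip f f)) * f w) \<in> S" if f: "f \<in> U" "f \<noteq> (\<lambda>_. 0)" for f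
  proof -
    have "?ip (\<lambda>w. (1 / sqrt (?ip f f)) * f w) (\<lambda>w. (1 / sqrt (?ip f f)) * f w)
      = (1 / sqrt (?ip f f))\<^sup>2 * ?ip f f"
      unfolding sum_distrib_left by (intro sum.cong refl) (simp add: power2_eq_square)
    also have "\<dots> = 1"
      using pos[OF f] by (simp add: power_divide)
    finally show ?thesis
      using subspace[OF f(1) f(1), of "1 / sqrt (?ip f f)" 0] by (simp add: S_def)
  qed
  have S_ne: "S \<noteq> {}" using normalize[OF y] by blast
  have cont_q: "continuous_on S (\<lambda>f. ?ip (A f) f)"
    by (rule continuous_on_subset[of UNIV])
      (intro continuous_intros continuous_on_product_coordinates cont, simp)
  obtain z where z: "z \<in> S" and max: "\<And>f. f \<in> S \<Longrightarrow> ?ip (A f) f \<le> ?ip (A z) z"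
    using continuous_attains_sup[OF compact_S S_ne cont_q] by blast
  define b where "b = ?ip (A z) z"
  have zU: "z \<in> U" and z1: "?ip z z = 1" using z by (auto simp: S_def)
  have scale: "A (\<lambda>w. c * f w) = (\<lambda>w. c * A f w)" for c f
    using lin[of c f 0 f] by simp
  have bound: "?ip (A f) f \<le> b * ?ip f f" if f: "f \<in> U" for f
  proof (cases "f = (\<lambda>_. 0)")
    case True
    then show ?thesis by simp
  next
    case False
    let ?c = "1 / sqrt (?ip f f)"
    have "?ip (A (\<lambda>w. ?c * f w)) (\<lambda>w. ?c * f w) = ?c\<^sup>2 * ?ip (A f) f"
      unfolding sum_distrib_left scale by (intro sum.cong refl) (simp add: power2_eq_square)
    then have "?c\<^sup>2 * ?ip (A f) f \<le> b"
      using max[OF normalize[OF f False]] by (simp add: b_def)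
    moreover have "?c\<^sup>2 = 1 / ?ip f f"
      using pos[OF f False] by (simp add: power_divide)
    ultimately show ?thesis
      using pos[OF f False] by (simp add: field_simps)
  qed
  define h where "h = (\<lambda>w. 1 * A z w + (- b) * z w)"
  have hU: "h \<in> U" unfolding h_def by (intro subspace inv zU)
  \<comment> \<open>Compare the quadratic form at \<open>z\<close> and at \<open>z + t h\<close>, where \<open>h\<close> is the defect of the eigenvector equation.\<close>
  have variation: "2 * t * ?ip h h \<le> t\<^sup>2 * (b * ?ip h h - ?ip (A h) h)" for t
  proof -
    define g where "g = (\<lambda>w. 1 * z w + t * h w)"
    have "g \<in> U" unfolding g_def by (intro subspace zU hU)
    from bound[OF this] have "?ip (A g) g \<le> b * ?ip g g" .
    moreover have "?ip g g = ?ip z z + 2 * t * ?ip z h + t\<^sup>2 * ?ip h h"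
      unfolding g_def sum_distrib_left sum.distrib[symmetric]
      by (intro sum.cong refl) (simp add: algebra_simps power2_eq_square)
    moreover have "?ip (A g) g = ?ip (A z) z + t * ?ip (A z) h + t * ?ip (A h) z + t\<^sup>2 * ?ip (A h) h"
      unfolding g_def lin sum_distrib_left sum.distrib[symmetric]
      by (intro sum.cong refl) (simp add: algebra_simps power2_eq_square)
    moreover have "?ip (A h) z = ?ip (A z) h"
      unfolding sym[of h z] by (simp add: mult.commute)
    ultimately have "b + t * ?ip (A z) h + t * ?ip (A z) h + t\<^sup>2 * ?ip (A h) h
        \<le> b * (1 + 2 * t * ?ip z h + t\<^sup>2 * ?ip h h)"
      by (simp only: z1 b_def)
    moreover have "?ip h h = ?ip (A z) h - b * ?ip z h"
    proof -
      have "?ip h h = (\<Sum>w\<in>X. A z w * h w - b * (z w * h w))"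
        by (intro sum.cong refl) (simp add: h_def algebra_simps)
      then show ?thesis by (simp add: sum_subtractf sum_distrib_left)
    qed
    moreover have "2 * t * H \<le> t\<^sup>2 * (b * H - Q)"
      if "b + t * \<alpha> + t * \<alpha> + t\<^sup>2 * Q \<le> b * (1 + 2 * t * \<beta> + t\<^sup>2 * H)" "H = \<alpha> - b * \<beta>"
      for \<alpha> \<beta> H Q :: real
    proof -
      have "2 * t * H = 2 * (t * \<alpha>) - 2 * (b * (t * \<beta>))"
        unfolding that(2) by (simp add: algebra_simps)
      moreover have "2 * (t * \<alpha>) - 2 * (b * (t * \<beta>)) \<le> t\<^sup>2 * (b * H - Q)"
        using that(1) by (simp add: algebra_simps)
      ultimately show ?thesis by linarith
    qed
    ultimately show ?thesis by blast
  qed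
  have "h = (\<lambda>_. 0)"
  proof (rule ccontr)
    assume "h \<noteq> (\<lambda>_. 0)"
    then have p: "?ip h h > 0" by (rule pos[OF hU])
    define P where "P = ?ip h h"
    define C where "C = b * ?ip h h - ?ip (A h) h"
    have P: "0 < P" using p by (simp add: P_def)
    have PC: "2 * t * P \<le> t\<^sup>2 * C" for t
      using variation[of t] by (simp only: P_def C_def)
    have C: "0 < C" using PC[of 1] P by simp
    \<comment> \<open>The choice \<open>t = P / C\<close> makes the quadratic term half of the linear one.\<close>
    have "2 * (P / C) * P \<le> (P / C)\<^sup>2 * C" by (rule PC)
    also have "\<dots> = (P / C) * P" using C by (simp add: power2_eq_square)
    finally have "(P / C) * P \<le> 0" by simp
    moreover have "0 < (P / C) * P" using P C by simp
    ultimately show False by simp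
  qed
  then have "A z = (\<lambda>w. b * z w)"
    by (auto simp: h_def fun_eq_iff)
  moreover have "z \<noteq> (\<lambda>_. 0)" using z1 by auto
  ultimately show ?thesis using that zU by blast
qed

section \<open>Functions on an invariant set of words\<close>

text \<open>
  Words are functions on all natural numbers, of which only the positions \<open>1, \<dots>, n\<close> are permuted. The
  groups \<open>S\<^sub>m\<close> with \<open>m \<le> n\<close> act on the same set \<open>X\<close> through the first \<open>m\<close> positions, so inductions on \<open>m\<close>
  leave the space of functions unchanged.
\<close>

locale word_space =
  fixes X :: "(nat \<Rightarrow> 'a) set" and n :: nat
  assumes finite_X: "finite X"
    and closed_X: "w \<in> X \<Longrightarrow> \<sigma> permutes {1..n} \<Longrightarrow> w \<circ> \<sigma> \<in> X"
begin

definition ip :: "((nat \<Rightarrow> 'a) \<Rightarrow> real) \<Rightarrow> ((nat \<Rightarrow> 'a) \<Rightarrow> real) \<Rightarrow> real" where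
  "ip f g = (\<Sum>w\<in>X. f w * g w)"

definition supported :: "((nat \<Rightarrow> 'a) \<Rightarrow> real) \<Rightarrow> bool" where
  "supported f \<longleftrightarrow> (\<forall>w. w \<notin> X \<longrightarrow> f w = 0)"

lemma ip_commute: "ip f g = ip g f"
  by (simp add: ip_def mult.commute)

lemma ip_nonneg: "0 \<le> ip f f"
  by (simp add: ip_def sum_nonneg)

lemma ip_self_eq_0: "supported f \<Longrightarrow> ip f f \<le> 0 \<Longrightarrow> f = (\<lambda>_. 0)"
proof -
  assume f: "supported f" "ip f f \<le> 0"
  then have "ip f f = 0" using ip_nonneg[of f] by simp
  then have "\<forall>w\<in>X. f w * f w = 0"
    unfolding ip_def by (subst (asm) sum_nonneg_eq_0_iff) (auto simp: finite_X)
  then show ?thesis using f(1) by (fastforce simp: supported_def)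
qed

lemma ip_sum_left: "ip (\<lambda>w. \<Sum>i\<in>I. f i w) g = (\<Sum>i\<in>I. ip (f i) g)"
  unfolding ip_def sum_distrib_right by (rule sum.swap)

lemma ip_sum_right: "ip f (\<lambda>w. \<Sum>i\<in>I. g i w) = (\<Sum>i\<in>I. ip f (g i))"
  unfolding ip_def sum_distrib_left by (rule sum.swap)

lemma bij_betw_act:
  assumes "\<sigma> permutes {1..n}"
  shows "bij_betw (\<lambda>w. w \<circ> \<sigma>) X X"
proof (rule bij_betw_byWitness[where f' = "\<lambda>w. w \<circ> inv_into UNIV \<sigma>"])
  show "(\<lambda>w. w \<circ> \<sigma>) ` X \<subseteq> X" "(\<lambda>w. w \<circ> inv_into UNIV \<sigma>) ` X \<subseteq> X"
    using closed_X assms permutes_inv[OF assms] by auto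
qed (simp_all add: o_assoc[symmetric] permutes_inv_o[OF assms])

lemma act_in_X_iff:
  assumes "\<sigma> permutes {1..n}"
  shows "w \<circ> \<sigma> \<in> X \<longleftrightarrow> w \<in> X"
proof
  assume "w \<circ> \<sigma> \<in> X"
  then have "w \<circ> \<sigma> \<circ> inv_into UNIV \<sigma> \<in> X"
    by (rule closed_X) (rule permutes_inv[OF assms])
  then show "w \<in> X" by (simp add: o_assoc[symmetric] permutes_inv_o[OF assms])
qed (rule closed_X[OF _ assms])

lemma supported_act: "supported f \<Longrightarrow> \<sigma> permutes {1..n} \<Longrightarrow> supported (\<lambda>w. f (w \<circ> \<sigma>))"
  by (simp add: supported_def act_in_X_iff)

lemma supported_sum: "(\<And>i. i \<in> I \<Longrightarrow> supported (f i)) \<Longrightarrow> supported (\<lambda>w. \<Sum>i\<in>I. f i w)"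
  by (simp add: supported_def)

lemma supported_lin: "supported f \<Longrightarrow> supported g \<Longrightarrow> supported (\<lambda>w. a * f w + b * g w)"
  by (simp add: supported_def)

lemma ip_act:
  assumes "\<sigma> permutes {1..n}" and "\<sigma> \<circ> \<rho> = id"
  shows "ip (\<lambda>w. f (w \<circ> \<sigma>)) g = ip f (\<lambda>w. g (w \<circ> \<rho>))"
proof -
  have "ip f (\<lambda>w. g (w \<circ> \<rho>)) = (\<Sum>w\<in>X. f (w \<circ> \<sigma>) * g (w \<circ> \<sigma> \<circ> \<rho>))"
    unfolding ip_def by (rule sum.reindex_bij_betw[OF bij_betw_act[OF assms(1)], symmetric])
  then show ?thesis by (simp add: ip_def o_assoc[symmetric] assms(2))
qed

lemma cyc_permutes_n: "m \<le> n \<Longrightarrow> i \<in> {1..m} \<Longrightarrow> j \<in> {1..m} \<Longrightarrow> cyc i j permutes {1..n}"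
  by (rule cyc_permutes) auto

lemma transpose_permutes_n: "m \<le> n \<Longrightarrow> i \<in> {1..<m} \<Longrightarrow> transpose i m permutes {1..n}"
  by (rule permutes_swap_id) auto

lemma supported_last_to_random: "m \<le> n \<Longrightarrow> supported f \<Longrightarrow> supported (last_to_random m f)"
  unfolding last_to_random_def
  by (rule supported_sum, rule supported_act, assumption, rule cyc_permutes_n[of m]) auto

lemma supported_random_to_last: "m \<le> n \<Longrightarrow> supported f \<Longrightarrow> supported (random_to_last m f)"
  unfolding random_to_last_def
  by (rule supported_sum, rule supported_act, assumption, rule cyc_permutes_n[of m]) auto

lemma supported_jucys_murphy: "m \<le> n \<Longrightarrow> supported f \<Longrightarrow> supported (jucys_murphy m f)"
  unfolding jucys_murphy_def
  by (rule supported_sum, rule supported_act, assumption, rule transpose_permutes_n[of m])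

lemma supported_swap: "1 \<le> m \<Longrightarrow> m < n \<Longrightarrow> supported f \<Longrightarrow> supported (swap m f)"
  unfolding swap_def by (rule supported_act) (auto intro: permutes_swap_id)

lemma ip_random_to_last:
  assumes "m \<le> n"
  shows "ip (random_to_last m f) g = ip f (last_to_random m g)"
  unfolding random_to_last_def last_to_random_def ip_sum_left ip_sum_right
  using assms by (intro sum.cong refl ip_act) (auto simp del: One_nat_def intro: cyc_permutes_n cyc_inverse)

lemma ip_jucys_murphy:
  assumes "m \<le> n"
  shows "ip (jucys_murphy m f) g = ip f (jucys_murphy m g)"
  unfolding jucys_murphy_def ip_sum_left ip_sum_right
  using assms by (intro sum.cong refl ip_act) (auto simp del: One_nat_def intro: transpose_permutes_n)

lemma ip_random_to_random:
  "m \<le> n \<Longrightarrow> ip (random_to_random m f) g = ip (last_to_random m f) (last_to_random m g)"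
  unfolding random_to_random_factor by (rule ip_random_to_last)

lemma ip_act_le:
  assumes "\<sigma> permutes {1..n}"
  shows "ip (\<lambda>w. f (w \<circ> \<sigma>)) f \<le> ip f f"
proof -
  have "ip (\<lambda>w. f (w \<circ> \<sigma>)) f \<le> (\<Sum>w\<in>X. (f (w \<circ> \<sigma>) * f (w \<circ> \<sigma>) + f w * f w) / 2)"
    unfolding ip_def
  proof (rule sum_mono)
    fix w
    have "0 \<le> (f (w \<circ> \<sigma>) - f w)\<^sup>2" by simp
    then show "f (w \<circ> \<sigma>) * f w \<le> (f (w \<circ> \<sigma>) * f (w \<circ> \<sigma>) + f w * f w) / 2"
      by (simp add: power2_eq_square algebra_simps)
  qed
  also have "\<dots> = (ip f f + ip f f) / 2"
    unfolding ip_def sum_divide_distrib[symmetric] sum.distrib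
    using sum.reindex_bij_betw[OF bij_betw_act[OF assms], of "\<lambda>w. f w * f w"] by simp
  finally show ?thesis by simp
qed

section \<open>The spectral gap of star transpositions and of random-to-random\<close>

text \<open>
  A sum of \<open>m - 1\<close> isometries.
\<close>

lemma jucys_murphy_norm:
  assumes "1 \<le> m" "m \<le> n"
  shows "ip (jucys_murphy m f) f \<le> (real m - 1) * ip f f"
proof -
  have "ip (jucys_murphy m f) f \<le> (\<Sum>i\<in>{1..<m}. ip f f)"
    unfolding jucys_murphy_def ip_sum_left
    using assms by (intro sum_mono ip_act_le transpose_permutes_n)
  then show ?thesis using assms by (simp add: of_nat_diff)
qed

lemma jucys_murphy_no_large_eigenvalue:
  assumes "1 \<le> m" "m \<le> n" "supported z" "jucys_murphy m z = (\<lambda>w. c * z w)" "c > real m - 1"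
  shows "z = (\<lambda>_. 0)"
proof (rule ip_self_eq_0[OF assms(3)])
  have "c * ip z z = ip (jucys_murphy m z) z"
    unfolding assms(4) by (simp add: ip_def sum_distrib_left mult.assoc)
  also have "\<dots> \<le> (real m - 1) * ip z z"
    by (rule jucys_murphy_norm[OF assms(1,2)])
  finally have "(c - (real m - 1)) * ip z z \<le> 0" by (simp add: algebra_simps)
  then show "ip z z \<le> 0" using assms(5) by (simp add: mult_le_0_iff)
qed

text \<open>
  Let \<open>K = J\<^sub>m\<close>, \<open>J = J\<^sub>m\<^sub>+\<^sub>1\<close>, and \<open>s = (m m+1)\<close>. If \<open>J v = b v\<close>, the relation \<open>K s = s J - 1\<close>
  makes \<open>s (b - K) v - v\<close> an eigenvector of \<open>K\<close> for \<open>b\<close>. This exceeds \<open>m - 1\<close>, the norm bound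
  of \<open>K\<close>, so the vector vanishes and \<open>(b - K) v = s v\<close>. Applied to \<open>x\<close> and to \<open>s x\<close>, this shows that
  \<open>s x - x\<close> is an eigenvector of \<open>K\<close> for \<open>b + 1\<close> and hence vanishes too. So \<open>x\<close> is fixed
  by \<open>s\<close> and is an eigenvector of \<open>K\<close> for \<open>b - 1\<close>, to which the induction hypothesis applies.
\<close>

lemma jucys_murphy_gap:
  assumes "1 \<le> m" "m \<le> n" "supported x" "jucys_murphy m x = (\<lambda>w. b * x w)" "b > real m - 2"
  shows "symmetric_under m x"
  using assms
proof (induction m arbitrary: b rule: nat_induct_at_least)
  case base
  then show ?case by (simp add: symmetric_under_def)
next
  case (Suc m)
  let ?K = "jucys_murphy m" and ?J = "jucys_murphy (Suc m)"
  have mn: "1 \<le> m" "m \<le> n" "m < n" using Suc by auto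
  have b: "b > real m - 1" using Suc.prems by simp
  have key: "(\<lambda>w. b * v w + (- 1) * ?K v w) = swap m v"
    if v: "supported v" "?J v = (\<lambda>w. b * v w)" for v
  proof -
    define u where "u = (\<lambda>w. b * v w + (- 1) * ?K v w)"
    have u: "supported u"
      unfolding u_def by (intro supported_lin v supported_jucys_murphy mn)
    have Ju: "?J u = (\<lambda>w. b * u w)"
    proof -
      have "?J (?K v) = (\<lambda>w. b * ?K v w)"
        unfolding jucys_murphy_commute v(2) using jucys_murphy_lin[of m b v 0 v] by simp
      then show ?thesis
        unfolding u_def jucys_murphy_lin v(2) by (simp add: algebra_simps)
    qed
    define z where "z = (\<lambda>w. 1 * swap m u w + (- 1) * v w)"
    have "?K (swap m u) = (\<lambda>w. b * swap m u w - u w)"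
      using jucys_murphy_swap[of m u] mn Ju by (simp add: swap_def fun_eq_iff)
    then have "?K z = (\<lambda>w. 1 * (b * swap m u w - u w) + (- 1) * ?K v w)"
      unfolding z_def jucys_murphy_lin by simp
    also have "\<dots> = (\<lambda>w. b * z w)"
      by (simp add: z_def u_def algebra_simps)
    finally have "?K z = (\<lambda>w. b * z w)" .
    moreover have "supported z"
      unfolding z_def by (intro supported_lin v supported_swap u mn)
    ultimately have "z = (\<lambda>_. 0)"
      using jucys_murphy_no_large_eigenvalue[OF mn(1,2)] b by blast
    then have "swap m u = v" by (auto simp: z_def fun_eq_iff)
    then have "swap m v = swap m (swap m u)" by simp
    also have "\<dots> = u" by (simp add: swap_def o_assoc[symmetric])
    finally show ?thesis by (simp add: u_def)
  qed
  let ?x' = "swap m x"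
  have x: "supported x" "?J x = (\<lambda>w. b * x w)" using Suc.prems by auto
  have Kx: "?K x w = b * x w - ?x' w" for w
    using fun_cong[OF key[OF x], of w] by simp
  have x': "supported ?x'" by (rule supported_swap) (use mn x in auto)
  have "?J ?x' = (\<lambda>w. b * ?x' w)"
  proof -
    have "?J (?K x) = (\<lambda>w. b * ?K x w)"
      unfolding jucys_murphy_commute x(2) using jucys_murphy_lin[of m b x 0 x] by simp
    moreover have "?x' = (\<lambda>w. b * x w + (- 1) * ?K x w)" using key[OF x] by simp
    ultimately show ?thesis
      by (simp only: jucys_murphy_lin x(2)) (simp add: algebra_simps)
  qed
  from key[OF x' this] have Kx': "?K ?x' w = b * ?x' w - x w" for w
    by (auto simp: fun_eq_iff swap_def o_assoc[symmetric] algebra_simps)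
  have "?K (\<lambda>w. 1 * ?x' w + (- 1) * x w) = (\<lambda>w. (b + 1) * (1 * ?x' w + (- 1) * x w))"
    unfolding jucys_murphy_lin Kx Kx' by (simp add: algebra_simps)
  then have "(\<lambda>w. 1 * ?x' w + (- 1) * x w) = (\<lambda>_. 0)"
    by (rule jucys_murphy_no_large_eigenvalue[OF mn(1,2) supported_lin[OF x' x(1)]]) (use b in simp)
  then have swap: "?x' = x" by (auto simp: fun_eq_iff)
  have "?K x = (\<lambda>w. (b - 1) * x w)"
    using Kx swap by (auto simp: fun_eq_iff algebra_simps)
  then have "symmetric_under m x"
    by (intro Suc.IH[of "b - 1"]) (use mn x b in auto)
  then show ?case using swap mn by (simp add: symmetric_under_Suc)
qed

text \<open>
  Equivalently, the sums of \<open>f\<close> over the \<open>S\<^sub>m\<close>-orbits vanish. Orthogonality to the invariant functions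
  is the form that passes through adjoint operators.
\<close>

definition mean_free :: "nat \<Rightarrow> ((nat \<Rightarrow> 'a) \<Rightarrow> real) \<Rightarrow> bool" where
  "mean_free m f \<longleftrightarrow> supported f \<and> (\<forall>g. supported g \<and> symmetric_under m g \<longrightarrow> ip f g = 0)"

lemma mean_free_symmetric_under: "mean_free m f \<Longrightarrow> symmetric_under m f \<Longrightarrow> f = (\<lambda>_. 0)"
  unfolding mean_free_def by (intro ip_self_eq_0) auto

lemma ip_lin_left: "ip (\<lambda>w. a * f w + b * g w) h = a * ip f h + b * ip g h"
  by (simp add: ip_def sum.distrib sum_distrib_left algebra_simps)

lemma closed_mean_free: "closed {f. mean_free m f}"
  unfolding mean_free_def supported_def ip_def
  by (intro closed_Collect_conj closed_Collect_all closed_Collect_imp open_Collect_const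
      closed_Collect_eq continuous_intros continuous_on_product_coordinates)

text \<open>
  For \<open>m = 1\<close> every function is invariant, so there is no such \<open>x\<close>. In the step, \<open>y = D x\<close> is
  orthogonal to the functions \<open>g\<close> invariant under the smaller group because the adjoint of \<open>D\<close> makes
  \<open>g\<close> invariant under the larger one. The set \<open>U\<close> collects what is
  known about \<open>y\<close>; it is stable under \<open>J\<close>, so it contains an eigenvector of \<open>J\<close>.
\<close>

lemma random_to_random_gap:
  assumes "1 \<le> m" "m \<le> n" "mean_free m x" "x \<noteq> (\<lambda>_. 0)"
    and "random_to_random m x = (\<lambda>w. \<epsilon> * x w)"
  shows "\<epsilon> \<le> (real m)\<^sup>2 - real m - 2"
  using assms
proof (induction m arbitrary: x \<epsilon> rule: nat_induct_at_least)
  case base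
  have "symmetric_under 1 x" by (simp add: symmetric_under_def)
  then show ?case using mean_free_symmetric_under base by blast
next
  case (Suc m)
  let ?N = "Suc m"
  have mn: "1 \<le> m" "m \<le> n" "?N \<le> n" using Suc by auto
  define y where "y = last_to_random ?N x"
  have x: "supported x" using Suc.prems by (simp add: mean_free_def)
  show ?case
  proof (cases "y = (\<lambda>_. 0)")
    case True
    then have "random_to_random ?N x = (\<lambda>_. 0)"
      unfolding random_to_random_factor y_def[symmetric] by (simp add: random_to_last_def)
    then have "\<epsilon> = 0" using Suc.prems by (auto simp: fun_eq_iff)
    moreover have "real m * real m \<ge> 1 * 1" using mn by (intro mult_mono) auto
    ultimately show ?thesis using mn by (simp add: power2_eq_square algebra_simps)
  next
    case False
    define c where "c = \<epsilon> - real ?N"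
    define U where "U = {f. mean_free m f \<and> (\<forall>w. jucys_murphy ?N f w + random_to_random m f w = c * f w)}"
    have "mean_free m y"
      unfolding mean_free_def
    proof (intro conjI allI impI)
      show "supported y" unfolding y_def by (rule supported_last_to_random[OF mn(3) x])
      fix g assume g: "supported g \<and> symmetric_under m g"
      have "ip y g = ip x (random_to_last ?N g)"
        unfolding y_def by (metis ip_commute ip_random_to_last[OF mn(3)])
      also have "\<dots> = 0"
        using Suc.prems g mn supported_random_to_last[OF mn(3), of g]
          symmetric_under_random_to_last[of m g] by (auto simp: mean_free_def)
      finally show "ip y g = 0" .
    qed
    moreover have "jucys_murphy ?N y w + random_to_random m y w = c * y w" for w
    proof -
      have "last_to_random ?N (random_to_random ?N x) w = \<epsilon> * y w"
        unfolding Suc.prems(4) y_def by (simp only: last_to_random_def sum_distrib_left)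
      then show ?thesis
        unfolding last_to_random_intertwines y_def[symmetric] by (simp add: c_def algebra_simps)
    qed
    ultimately have yU: "y \<in> U" by (simp add: U_def)
    have lin: "(\<lambda>w. a * f w + b * g w) \<in> U" if "f \<in> U" "g \<in> U" for f g a b
    proof -
      have *: "jucys_murphy ?N f w + random_to_random m f w = c * f w"
        "jucys_murphy ?N g w + random_to_random m g w = c * g w" for w
        using that by (auto simp: U_def)
      have "(a * jucys_murphy ?N f w + b * jucys_murphy ?N g w)
          + (a * random_to_random m f w + b * random_to_random m g w) = c * (a * f w + b * g w)" for w
      proof -
        have "(a * jucys_murphy ?N f w + b * jucys_murphy ?N g w)
            + (a * random_to_random m f w + b * random_to_random m g w)
          = a * (jucys_murphy ?N f w + random_to_random m f w)
            + b * (jucys_murphy ?N g w + random_to_random m g w)"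
          by (simp add: algebra_simps)
        also have "\<dots> = c * (a * f w + b * g w)"
          unfolding * by (simp add: algebra_simps)
        finally show ?thesis .
      qed
      then show ?thesis
        using that by (simp add: U_def mean_free_def supported_lin ip_lin_left jucys_murphy_lin
            random_to_random_lin)
    qed
    have inv: "jucys_murphy ?N f \<in> U" if f: "f \<in> U" for f
    proof -
      have "mean_free m (jucys_murphy ?N f)"
        unfolding mean_free_def
      proof (intro conjI allI impI)
        show "supported (jucys_murphy ?N f)"
          using f mn supported_jucys_murphy by (auto simp: U_def mean_free_def)
        fix g assume g: "supported g \<and> symmetric_under m g"
        then have "supported (jucys_murphy ?N g)" "symmetric_under m (jucys_murphy ?N g)"
          using supported_jucys_murphy[OF mn(3)] symmetric_under_jucys_murphy by auto
        then show "ip (jucys_murphy ?N f) g = 0"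
          unfolding ip_jucys_murphy[OF mn(3)] using f by (auto simp: U_def mean_free_def)
      qed
      moreover have "jucys_murphy ?N (jucys_murphy ?N f) w + random_to_random m (jucys_murphy ?N f) w
        = c * jucys_murphy ?N f w" for w
      proof -
        have "(\<lambda>w. 1 * jucys_murphy ?N f w + 1 * random_to_random m f w) = (\<lambda>w. c * f w + 0 * f w)"
          using f by (auto simp: U_def)
        from arg_cong[OF this, of "\<lambda>h. jucys_murphy ?N h w"] show ?thesis
          unfolding jucys_murphy_lin by (simp add: jucys_murphy_random_to_random)
      qed
      ultimately show ?thesis by (simp add: U_def)
    qed
    have closed: "closed U"
      unfolding U_def
      by (intro closed_Collect_conj closed_Collect_all closed_Collect_eq closed_mean_free
          continuous_intros jucys_murphy_continuous random_to_random_continuous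
          continuous_on_product_coordinates)
    have supp: "f w = 0" if "f \<in> U" "w \<notin> X" for f w
      using that by (auto simp: U_def mean_free_def supported_def)
    obtain z b where z: "z \<in> U" "z \<noteq> (\<lambda>_. 0)" "jucys_murphy ?N z = (\<lambda>w. b * z w)"
    proof (rule symmetric_operator_eigenvector[where A = "jucys_murphy ?N" and X = X and U = U and y = y])
      show "(\<Sum>w\<in>X. jucys_murphy ?N f w * g w) = (\<Sum>w\<in>X. f w * jucys_murphy ?N g w)" for f g
        using ip_jucys_murphy[OF mn(3)] by (simp add: ip_def)
    qed (use finite_X closed supp lin inv jucys_murphy_lin jucys_murphy_continuous yU False in \<open>auto\<close>)
    have zm: "mean_free m z" using z by (simp add: U_def)
    have "random_to_random m z = (\<lambda>w. (c - b) * z w)"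
      using z by (auto simp: U_def fun_eq_iff algebra_simps)
    from Suc.IH[OF mn(2) zm z(2) this] have 1: "c - b \<le> (real m)\<^sup>2 - real m - 2" .
    have 2: "b \<le> real ?N - 2"
    proof (rule ccontr)
      assume "\<not> ?thesis"
      then have "symmetric_under ?N z"
        using jucys_murphy_gap[of ?N z b] mn z(3) zm by (auto simp: mean_free_def)
      then have "symmetric_under m z" using mn by (simp add: symmetric_under_Suc)
      then show False using mean_free_symmetric_under[OF zm] z(2) by blast
    qed
    show ?thesis using 1 2 by (simp add: c_def power2_eq_square algebra_simps)
  qed
qed

end

section \<open>Sets of words forming a single orbit\<close>

text \<open>
  The cycle is the product of the adjacent transpositions at \<open>i, \<dots>, n - 1\<close>.
\<close>

lemma cyc_closed:
  assumes "\<And>w k. w \<in> S \<Longrightarrow> 1 \<le> k \<Longrightarrow> k < n \<Longrightarrow> w \<circ> transpose k (Suc k) \<in> S"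
    and "1 \<le> i" "i \<le> n" "w \<in> S"
  shows "w \<circ> cyc i n \<in> S"
  using \<open>i \<le> n\<close> assms(2,4)
proof (induction i arbitrary: w rule: inc_induct)
  case base
  then show ?case by simp
next
  case (step i)
  have "w \<circ> transpose i (Suc i) \<in> S"
    by (rule assms(1)) (use step in simp_all)
  moreover have "1 \<le> Suc i" by simp
  ultimately have "(w \<circ> transpose i (Suc i)) \<circ> cyc (Suc i) n \<in> S"
    by (rule step.IH[rotated])
  then show ?case
    using transpose_cyc_at(2)[OF \<open>i < n\<close>] by (simp only: o_assoc[symmetric])
qed

text \<open>
  Factor \<open>\<sigma>\<close> into a cycle that brings the right letter to the last position and a permutation of
  the positions before it.
\<close>

lemma adjacent_transpositions_generate:
  assumes "\<And>w k. w \<in> S \<Longrightarrow> 1 \<le> k \<Longrightarrow> k < n \<Longrightarrow> w \<circ> transpose k (Suc k) \<in> S"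
    and "\<sigma> permutes {1..n}" and "w \<in> S"
  shows "w \<circ> \<sigma> \<in> S"
  using assms
proof (induction n arbitrary: \<sigma> w)
  case 0
  then show ?case by simp
next
  case (Suc m)
  let ?N = "Suc m"
  let ?i = "\<sigma> ?N"
  have i: "?i \<in> {1..?N}"
    using Suc.prems(2) by (metis permutes_in_image atLeastAtMost_iff le_refl le_add1 plus_1_eq_Suc)
  let ?\<rho> = "cyc ?N ?i \<circ> \<sigma>"
  have \<rho>: "?\<rho> permutes {1..?N}"
    using i by (intro permutes_compose[OF Suc.prems(2)] cyc_permutes) auto
  have "?\<rho> ?N = ?N" by (simp add: cyc_def)
  then have \<rho>': "?\<rho> permutes {1..m}"
    by (intro permutes_superset[OF \<rho>]) (auto simp: le_Suc_eq)
  have wi: "w \<circ> cyc ?i ?N \<in> S"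
    by (rule cyc_closed[OF Suc.prems(1)]) (use Suc.prems(3) i in simp_all)
  have adj: "u \<circ> transpose k (Suc k) \<in> S" if "u \<in> S" "1 \<le> k" "k < m" for u k
    by (rule Suc.prems(1)[OF that(1,2)]) (use that(3) in simp)
  have "(w \<circ> cyc ?i ?N) \<circ> ?\<rho> \<in> S"
    by (rule Suc.IH[OF adj \<rho>' wi])
  moreover have "cyc ?i ?N \<circ> ?\<rho> = \<sigma>"
    using cyc_inverse[of ?i ?N] by (simp add: o_assoc)
  ultimately show ?case by (simp only: o_assoc[symmetric])
qed

lemma symmetric_under_permutes:
  assumes "symmetric_under n g" "\<sigma> permutes {1..n}"
  shows "g (w \<circ> \<sigma>) = g w"
proof -
  have "w \<circ> \<sigma> \<in> {u. g u = g w}"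
    by (rule adjacent_transpositions_generate[OF _ assms(2)])
      (use assms(1) in \<open>auto simp: symmetric_under_def swap_def fun_eq_iff\<close>)
  then show ?thesis by simp
qed

context word_space
begin

text \<open>
  The operator is symmetric and multiplies constants by \<open>n\<^sup>2\<close>; in other words, the uniform
  distribution is stationary.
\<close>

lemma sum_random_to_random: "(\<Sum>w\<in>X. random_to_random n f w) = (real n)\<^sup>2 * (\<Sum>w\<in>X. f w)"
proof -
  have "(\<Sum>w\<in>X. random_to_random n f w) = (\<Sum>i\<in>{1..n}. \<Sum>j\<in>{1..n}. \<Sum>w\<in>X. f (w \<circ> cyc i j))"
    unfolding random_to_random_def by (subst sum.swap) (intro sum.cong refl sum.swap)
  also have "\<dots> = (\<Sum>i\<in>{1..n}. \<Sum>j\<in>{1..n}. \<Sum>w\<in>X. f w)"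
    by (intro sum.cong refl sum.reindex_bij_betw bij_betw_act cyc_permutes)
  finally show ?thesis by (simp add: power2_eq_square)
qed

lemma supported_random_to_random: "supported f \<Longrightarrow> supported (random_to_random n f)"
  unfolding random_to_random_factor by (intro supported_random_to_last supported_last_to_random) auto

lemma random_to_random_eigenvalue_nonneg:
  assumes "supported f" "f \<noteq> (\<lambda>_. 0)" "random_to_random n f = (\<lambda>w. \<kappa> * f w)"
  shows "0 \<le> \<kappa>"
proof (rule ccontr)
  assume "\<not> 0 \<le> \<kappa>"
  have "\<kappa> * ip f f = ip (random_to_random n f) f"
    unfolding assms(3) by (simp add: ip_def sum_distrib_left mult.assoc)
  also have "\<dots> \<ge> 0"
    by (simp add: ip_random_to_random ip_nonneg)
  finally have "ip f f \<le> 0" using \<open>\<not> 0 \<le> \<kappa>\<close> by (simp add: zero_le_mult_iff)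
  then show False using ip_self_eq_0 assms by blast
qed

text \<open>
  Subtracting the mean makes \<open>g\<close> orthogonal to the constants, which on an orbit are the only
  invariant functions. Summation over all words then shows that the inhomogeneous term disappears,
  because the sum of the shifted function is zero. The inhomogeneous form is what an eigenvector of
  the matrix induced on the quotient by the constants satisfies.
\<close>

lemma random_to_random_gap_modulo_constants:
  assumes trans: "\<And>u v. u \<in> X \<Longrightarrow> v \<in> X \<Longrightarrow> \<exists>\<sigma>. \<sigma> permutes {1..n} \<and> v = u \<circ> \<sigma>"
    and n: "1 \<le> n"
    and g: "\<And>w. w \<in> X \<Longrightarrow> random_to_random n g w = \<kappa> * g w + d"
    and nonconst: "u \<in> X" "v \<in> X" "g u \<noteq> g v"
  shows "\<kappa> \<le> (real n)\<^sup>2 - real n - 2"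
proof -
  have cX: "card X > 0" using nonconst finite_X by (auto simp: card_gt_0_iff)
  define s where "s = (\<Sum>w\<in>X. g w) / card X"
  define x where "x w = (if w \<in> X then g w - s else 0)" for w
  have x: "supported x" by (simp add: supported_def x_def)
  have sum_x: "(\<Sum>w\<in>X. x w) = 0"
    using cX by (simp add: x_def sum_subtractf s_def)
  have mf: "mean_free n x"
    unfolding mean_free_def
  proof (intro conjI x allI impI)
    fix h assume h: "supported h \<and> symmetric_under n h"
    have "h w = h u" if "w \<in> X" for w
      using trans[OF nonconst(1) that] symmetric_under_permutes[of n h] h by auto
    then have "ip x h = (\<Sum>w\<in>X. x w * h u)"
      unfolding ip_def by (intro sum.cong refl) simp
    then show "ip x h = 0" by (simp add: sum_distrib_right[symmetric] sum_x)
  qed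
  have x0: "x \<noteq> (\<lambda>_. 0)"
  proof
    assume "x = (\<lambda>_. 0)"
    then have "x u = 0" "x v = 0" by auto
    then show False using nonconst by (simp add: x_def)
  qed
  define e where "e = d - (real n)\<^sup>2 * s + \<kappa> * s"
  have Rx: "random_to_random n x w = \<kappa> * x w + e" if w: "w \<in> X" for w
  proof -
    have "random_to_random n x w = (\<Sum>i\<in>{1..n}. \<Sum>j\<in>{1..n}. g (w \<circ> cyc i j) - s)"
      unfolding random_to_random_def using w
      by (intro sum.cong refl) (simp add: x_def closed_X cyc_permutes del: o_apply One_nat_def)
    also have "\<dots> = random_to_random n g w - (real n)\<^sup>2 * s"
      by (simp add: random_to_random_def sum_subtractf power2_eq_square)
    finally show ?thesis
      using w by (simp add: g x_def e_def algebra_simps)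
  qed
  have "(\<Sum>w\<in>X. random_to_random n x w) = (\<Sum>w\<in>X. \<kappa> * x w + e)"
    by (intro sum.cong refl Rx)
  then have "0 = card X * e"
    unfolding sum_random_to_random by (simp add: sum.distrib sum_distrib_left[symmetric] sum_x)
  then have "e = 0" using cX by simp
  have "random_to_random n x = (\<lambda>w. \<kappa> * x w)"
  proof
    fix w
    show "random_to_random n x w = \<kappa> * x w"
      using Rx[of w] \<open>e = 0\<close> x supported_random_to_random[OF x]
      by (cases "w \<in> X") (auto simp: supported_def)
  qed
  then show ?thesis by (rule random_to_random_gap[OF n le_refl mf x0])
qed

end

section \<open>An eigenfunction attaining the bound\<close>

text \<open>
  When the letter at position \<open>i\<close> is moved to position \<open>j\<close>, the letter at position \<open>l\<close> ends up at
  position \<open>cyc j i l\<close>. For \<open>i = l\<close> this is uniform; for the other \<open>i\<close> it differs from \<open>l\<close> by at most one.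
  The count shows that the centred position is an eigenfunction of the walk of a single letter.
\<close>

lemma sum_cyc_position:
  assumes l: "l \<in> {1..n}"
  shows "(\<Sum>i\<in>{1..n}. \<Sum>j\<in>{1..n}. real (cyc j i l) - (real n + 1) / 2)
    = (real n + 1) * (real n - 2) * (real l - (real n + 1) / 2)"
proof -
  have ln: "1 \<le> l" "l \<le> n" using l by auto
  define F where "F i = (\<Sum>j\<in>{1..n}. real (cyc j i l))" for i
  have up: "F i = real n * l + l" if "l < i" for i
  proof -
    have "F i = (\<Sum>j\<in>{1..n}. real l + (if j \<in> {1..l} then 1 else 0))"
      unfolding F_def using that by (intro sum.cong refl) (auto simp: cyc_def)
    also have "\<dots> = real n * l + (\<Sum>j\<in>{1..n}. (if j \<in> {1..l} then 1 else 0))"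
      by (simp add: sum.distrib)
    also have "(\<Sum>j\<in>{1..n}. (if j \<in> {1..l} then 1 else 0)) = real (card ({1..n} \<inter> {1..l}))"
      by (subst sum.inter_restrict[symmetric]) auto
    also have "{1..n} \<inter> {1..l} = {1..l}" using ln by auto
    finally show ?thesis by simp
  qed
  have down: "F i = real n * l - (real n - l + 1)" if "i < l" for i
  proof -
    have "F i = (\<Sum>j\<in>{1..n}. real l - (if j \<in> {l..n} then 1 else 0))"
      unfolding F_def using that ln by (intro sum.cong refl) (auto simp: cyc_def of_nat_diff)
    also have "\<dots> = real n * l - (\<Sum>j\<in>{1..n}. (if j \<in> {l..n} then 1 else 0))"
      by (simp add: sum_subtractf)
    also have "(\<Sum>j\<in>{1..n}. (if j \<in> {l..n} then 1 else 0)) = real (card ({1..n} \<inter> {l..n}))"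
      by (subst sum.inter_restrict[symmetric]) auto
    also have "{1..n} \<inter> {l..n} = {l..n}" using ln by auto
    finally show ?thesis using ln by (simp add: of_nat_diff)
  qed
  have gauss: "(\<Sum>j\<in>{1..m}. real j) = real m * (real m + 1) / 2" for m
    by (induction m) (simp_all add: field_simps)
  have here: "F l = real n * (real n + 1) / 2"
    unfolding F_def using gauss[of n] by (simp add: cyc_def)
  have split: "{1..n} = {1..<l} \<union> ({l} \<union> {l<..n})" using ln by auto
  have "(\<Sum>i\<in>{1..n}. F i) = (\<Sum>i\<in>{1..<l}. F i) + F l + (\<Sum>i\<in>{l<..n}. F i)"
    unfolding split by (subst sum.union_disjoint) auto
  also have "(\<Sum>i\<in>{1..<l}. F i) = (real l - 1) * (real n * l - (real n - l + 1))"
    using ln by (simp add: down of_nat_diff)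
  also have "(\<Sum>i\<in>{l<..n}. F i) = (real n - l) * (real n * l + l)"
    using ln by (simp add: up of_nat_diff)
  finally have total: "(\<Sum>i\<in>{1..n}. F i) = (real l - 1) * (real n * l - (real n - l + 1))
      + real n * (real n + 1) / 2 + (real n - l) * (real n * l + l)"
    by (simp only: here)
  have "(\<Sum>i\<in>{1..n}. \<Sum>j\<in>{1..n}. real (cyc j i l) - (real n + 1) / 2)
      = (\<Sum>i\<in>{1..n}. F i) - real n * (real n * ((real n + 1) / 2))"
    by (simp add: sum_subtractf F_def)
  also have "\<dots> = (real n + 1) * (real n - 2) * (real l - (real n + 1) / 2)"
    unfolding total by (simp add: field_simps)
  finally show ?thesis .
qed

text \<open>
  Centring at \<open>(n + 1) / 2\<close> removes the component along the constants.
\<close>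

definition letter_position :: "nat \<Rightarrow> 'a \<Rightarrow> (nat \<Rightarrow> 'a) \<Rightarrow> real" where
  "letter_position n c w = (\<Sum>k\<in>{1..n}. if w k = c then real k - (real n + 1) / 2 else 0)"

lemma random_to_random_letter_position:
  "random_to_random n (letter_position n c) w = (real n + 1) * (real n - 2) * letter_position n c w"
proof -
  let ?m = "(real n + 1) / 2"
  have moved: "letter_position n c (w \<circ> cyc i j) = (\<Sum>l\<in>{1..n}. if w l = c then real (cyc j i l) - ?m else 0)"
    if "i \<in> {1..n}" "j \<in> {1..n}" for i j
  proof -
    have inv: "cyc j i (cyc i j k) = k" for k
      using cyc_inverse[of j i] by (metis comp_apply id_apply)
    have "(\<Sum>l\<in>{1..n}. if w l = c then real (cyc j i l) - ?m else 0)
      = (\<Sum>k\<in>{1..n}. if w (cyc i j k) = c then real (cyc j i (cyc i j k)) - ?m else 0)"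
      by (rule sum.reindex_bij_betw[symmetric]) (rule permutes_imp_bij[OF cyc_permutes[OF that]])
    then show ?thesis by (simp add: letter_position_def inv cong: if_cong)
  qed
  have "random_to_random n (letter_position n c) w
    = (\<Sum>i\<in>{1..n}. \<Sum>j\<in>{1..n}. \<Sum>l\<in>{1..n}. if w l = c then real (cyc j i l) - ?m else 0)"
    unfolding random_to_random_def by (intro sum.cong refl moved)
  also have "\<dots> = (\<Sum>l\<in>{1..n}. \<Sum>i\<in>{1..n}. \<Sum>j\<in>{1..n}. if w l = c then real (cyc j i l) - ?m else 0)"
    by (rule trans[OF sum.cong[OF refl sum.swap] sum.swap])
  also have "\<dots> = (\<Sum>l\<in>{1..n}. if w l = c then (real n + 1) * (real n - 2) * (real l - ?m) else 0)"
  proof (intro sum.cong refl)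
    fix l assume "l \<in> {1..n}"
    from sum_cyc_position[OF this]
    show "(\<Sum>i\<in>{1..n}. \<Sum>j\<in>{1..n}. if w l = c then real (cyc j i l) - ?m else 0)
        = (if w l = c then (real n + 1) * (real n - 2) * (real l - ?m) else 0)"
      by (cases "w l = c") simp_all
  qed
  also have "\<dots> = (real n + 1) * (real n - 2) * letter_position n c w"
    unfolding letter_position_def sum_distrib_left by (intro sum.cong refl) simp
  finally show ?thesis .
qed

text \<open>
  This change of value shows that the eigenfunction does not vanish identically.
\<close>

lemma letter_position_transpose:
  assumes ab: "a \<in> {1..n}" "b \<in> {1..n}" "w a = c" "w b \<noteq> c"
  shows "letter_position n c (w \<circ> transpose a b) = letter_position n c w + (real b - real a)"
proof -
  let ?m = "(real n + 1) / 2"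
  have "letter_position n c (w \<circ> transpose a b)
      = (\<Sum>k\<in>{1..n}. if w (transpose a b k) = c then real (transpose a b (transpose a b k)) - ?m else 0)"
    by (simp add: letter_position_def cong: if_cong)
  also have "\<dots> = (\<Sum>l\<in>{1..n}. if w l = c then real (transpose a b l) - ?m else 0)"
    by (rule sum.reindex_bij_betw) (rule permutes_imp_bij[OF permutes_swap_id[OF ab(1,2)]])
  also have "\<dots> = (\<Sum>l\<in>{1..n}. (if w l = c then real l - ?m else 0) + (if l = a then real b - real a else 0))"
    using ab(3,4) by (intro sum.cong refl) (auto simp: transpose_def)
  also have "\<dots> = letter_position n c w + (real b - real a)"
    unfolding letter_position_def sum.distrib using ab(1) by simp
  finally show ?thesis .
qed

section \<open>Splitting off the eigenvalue of the constants\<close>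

lemma sorted_list_of_multiset_two_largest:
  fixes M :: "real multiset"
  assumes "\<And>x. x \<in># M \<Longrightarrow> x \<le> a" "a \<le> b"
  shows "sorted_list_of_multiset (add_mset b (add_mset a M)) = sorted_list_of_multiset M @ [a, b]"
proof -
  let ?xs = "sorted_list_of_multiset M @ [a, b]"
  have "sorted ?xs" using assms by (auto simp: sorted_append intro: order_trans[OF assms(1)])
  moreover have "mset ?xs = add_mset b (add_mset a M)" by simp
  ultimately show ?thesis by (metis sorted_list_of_multiset_mset sorted_sort_id)
qed

text \<open>
  The all-ones vector is fixed by \<open>A\<close>. In the basis obtained by replacing the first unit vector with
  it, \<open>A\<close> is block upper triangular with diagonal blocks \<open>1\<close> and \<open>B\<close>, where \<open>B\<close> describes the action on
  the quotient by the constants.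
\<close>

lemma char_poly_constant_row_sums:
  fixes A :: "real mat"
  assumes A: "A \<in> carrier_mat (Suc m) (Suc m)"
    and rows: "\<And>i. i < Suc m \<Longrightarrow> (\<Sum>j<Suc m. A $$ (i, j)) = 1"
  defines "B \<equiv> mat m m (\<lambda>(i, j). A $$ (Suc i, Suc j) - A $$ (0, Suc j))"
  shows "char_poly A = [:-1, 1:] * char_poly B"
proof -
  define A2 where "A2 = mat 1 m (\<lambda>(i, j). A $$ (0, Suc j))"
  define A4 where "A4 = mat m m (\<lambda>(i, j). A $$ (Suc i, Suc j))"
  define u where "u = mat m 1 (\<lambda>_. 1 :: real)"
  \<comment> \<open>The columns of \<open>P\<close> are the new basis, and \<open>Q\<close> is its inverse.\<close>
  define P where "P = four_block_mat (1\<^sub>m 1) (0\<^sub>m 1 m) u (1\<^sub>m m)"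
  define Q where "Q = four_block_mat (1\<^sub>m 1) (0\<^sub>m 1 m) (- u) (1\<^sub>m m)"
  define T where "T = four_block_mat (1\<^sub>m 1) A2 (0\<^sub>m m 1) B"
  define A1 where "A1 = mat 1 1 (\<lambda>_. A $$ (0, 0))"
  define A3 where "A3 = mat m 1 (\<lambda>(i, j). A $$ (Suc i, 0))"
  have c0: "A1 \<in> carrier_mat 1 1" "A2 \<in> carrier_mat 1 m" "A3 \<in> carrier_mat m 1"
    "A4 \<in> carrier_mat m m" "u \<in> carrier_mat m 1" "- u \<in> carrier_mat m 1" "B \<in> carrier_mat m m"
    unfolding A1_def A2_def A3_def A4_def u_def B_def by simp_all
  have block: "four_block_mat (1\<^sub>m 1) V W Z \<in> carrier_mat (Suc m) (Suc m)"
    if "Z \<in> carrier_mat m m" for V W Z :: "real mat"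
    using four_block_carrier_mat[of "1\<^sub>m 1" 1 1 Z m m V W] that by simp
  have c: "P \<in> carrier_mat (Suc m) (Suc m)" "Q \<in> carrier_mat (Suc m) (Suc m)"
    "T \<in> carrier_mat (Suc m) (Suc m)"
    unfolding P_def Q_def T_def by (simp_all only: block c0 one_carrier_mat)
  note c = c0 c
  have A_block: "A = four_block_mat A1 A2 A3 A4"
    using A by (intro eq_matI) (auto simp: A1_def A2_def A3_def A4_def)
  have row_shift: "A $$ (i, 0) + (\<Sum>j<m. A $$ (i, Suc j)) = 1" if "i < Suc m" for i
    using rows[OF that] by (simp only: sum.lessThan_Suc_shift)
  have r1: "A1 + A2 * u = 1\<^sub>m 1"
    using row_shift[of 0]
    by (intro eq_matI) (auto simp: A1_def A2_def u_def scalar_prod_def atLeast0LessThan)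
  have r3: "A3 + A4 * u = u"
    using row_shift
    by (intro eq_matI) (auto simp: A3_def A4_def u_def scalar_prod_def atLeast0LessThan)
  have B4: "u * A2 + B = A4"
    by (intro eq_matI) (auto simp: A2_def A4_def u_def B_def scalar_prod_def)
  have "A * P = four_block_mat (A1 * 1\<^sub>m 1 + A2 * u) (A1 * 0\<^sub>m 1 m + A2 * 1\<^sub>m m)
      (A3 * 1\<^sub>m 1 + A4 * u) (A3 * 0\<^sub>m 1 m + A4 * 1\<^sub>m m)"
    unfolding A_block P_def by (rule mult_four_block_mat) (use c in auto)
  also have "\<dots> = four_block_mat (1\<^sub>m 1) A2 u A4"
    using c r1 r3 by simp
  finally have AP: "A * P = four_block_mat (1\<^sub>m 1) A2 u A4" .
  have "P * T = four_block_mat (1\<^sub>m 1 * 1\<^sub>m 1 + 0\<^sub>m 1 m * 0\<^sub>m m 1) (1\<^sub>m 1 * A2 + 0\<^sub>m 1 m * B)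
      (u * 1\<^sub>m 1 + 1\<^sub>m m * 0\<^sub>m m 1) (u * A2 + 1\<^sub>m m * B)"
    unfolding T_def P_def by (rule mult_four_block_mat) (use c in auto)
  also have "\<dots> = four_block_mat (1\<^sub>m 1) A2 u A4"
    using c B4 by simp
  finally have PT: "P * T = A * P" using AP by simp
  have inv: "four_block_mat (1\<^sub>m 1) (0\<^sub>m 1 m) v (1\<^sub>m m) * four_block_mat (1\<^sub>m 1) (0\<^sub>m 1 m) w (1\<^sub>m m)
      = 1\<^sub>m (Suc m)" if "v \<in> carrier_mat m 1" "w \<in> carrier_mat m 1" "v + w = 0\<^sub>m m 1" for v w :: "real mat"
  proof -
    have "four_block_mat (1\<^sub>m 1) (0\<^sub>m 1 m) v (1\<^sub>m m) * four_block_mat (1\<^sub>m 1) (0\<^sub>m 1 m) w (1\<^sub>m m)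
      = four_block_mat (1\<^sub>m 1 * 1\<^sub>m 1 + 0\<^sub>m 1 m * w) (1\<^sub>m 1 * 0\<^sub>m 1 m + 0\<^sub>m 1 m * 1\<^sub>m m)
        (v * 1\<^sub>m 1 + 1\<^sub>m m * w) (v * 0\<^sub>m 1 m + 1\<^sub>m m * 1\<^sub>m m)"
      by (rule mult_four_block_mat) (use that in auto)
    also have "\<dots> = four_block_mat (1\<^sub>m 1) (0\<^sub>m 1 m) (0\<^sub>m m 1) (1\<^sub>m m)"
      using that by simp
    finally show ?thesis by simp
  qed
  have PQ: "P * Q = 1\<^sub>m (Suc m)"
    unfolding P_def Q_def by (rule inv) (use c in \<open>auto intro!: eq_matI\<close>)
  have QP: "Q * P = 1\<^sub>m (Suc m)"
    unfolding P_def Q_def by (rule inv) (use c in \<open>auto intro!: eq_matI\<close>)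
  have "P * T * Q = A * (P * Q)"
    unfolding PT using A c by (intro assoc_mult_mat) auto
  then have "A = P * T * Q" using A by (simp add: PQ)
  then have "similar_mat A T"
    using A c PQ QP by (intro similar_matI[of _ _ P Q "Suc m"]) auto
  then have "char_poly A = char_poly T" by (rule char_poly_similar)
  also have "\<dots> = char_poly (1\<^sub>m 1) * char_poly B"
    unfolding T_def by (rule char_poly_four_block_zeros_col) (use c in auto)
  also have "char_poly (1\<^sub>m 1 :: real mat) = [:-1, 1:]"
    by (simp add: char_poly_def char_poly_matrix_def det_single)
  finally show ?thesis .
qed

section \<open>Linear extensions of a direct sum of chains as words\<close>

text \<open>
  Sorting by the number of elements below puts smaller elements first.
\<close>

lemma linear_extension_exists:
  assumes "partial_order_on {1..n} r"
  shows "linear_extensions n r \<noteq> {}"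
proof -
  have tr: "trans r" and an: "antisym r" and re: "refl_on {1..n} r" and sub: "r \<subseteq> {1..n} \<times> {1..n}"
    using assms by (auto simp: partial_order_on_def preorder_on_def)
  define h where "h x = card {y. (y, x) \<in> r}" for x
  have fin: "finite {y. (y, x) \<in> r}" for x
    by (rule finite_subset[of _ "{1..n}"]) (use sub in auto)
  have mono: "h x < h y" if "strictly_below r x y" for x y
    unfolding h_def
  proof (rule psubset_card_mono[OF fin])
    have xy: "(x, y) \<in> r" "x \<noteq> y" using that by (auto simp: strictly_below_def)
    then have "(y, y) \<in> r" using re sub by (auto simp: refl_on_def)
    moreover have "(y, x) \<notin> r" using an xy by (auto dest: antisymD)
    ultimately show "{z. (z, x) \<in> r} \<subset> {z. (z, y) \<in> r}"
      using transD[OF tr] xy by blast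
  qed
  define xs where "xs = sort_key h [1..<Suc n]"
  have len: "length xs = n" and dist: "distinct xs" and set: "set xs = {1..n}"
    by (auto simp: xs_def)
  define \<pi> where "\<pi> i = (if i \<in> {1..n} then xs ! (i - 1) else i)" for i
  have "bij_betw (\<lambda>i. i - 1) {1..n} {..<n}"
    by (rule bij_betw_byWitness[where f' = Suc]) auto
  moreover have "bij_betw ((!) xs) {..<n} {1..n}"
    using bij_betw_nth[OF dist] len set by auto
  ultimately have "bij_betw (\<lambda>i. xs ! (i - 1)) {1..n} {1..n}"
    using bij_betw_trans[of "\<lambda>i. i - 1" _ _ "(!) xs"] by (simp add: comp_def)
  then have "bij_betw \<pi> {1..n} {1..n}"
    by (rule bij_betw_cong[THEN iffD1, rotated]) (simp add: \<pi>_def)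
  then have "\<pi> permutes {1..n}"
    by (rule bij_imp_permutes) (auto simp: \<pi>_def)
  moreover have "i < j" if ij: "i \<in> {1..n}" "j \<in> {1..n}" "strictly_below r (\<pi> i) (\<pi> j)" for i j
  proof (rule ccontr)
    assume "\<not> i < j"
    then have le: "j - 1 \<le> i - 1" and i: "i - 1 < length xs" using ij len by auto
    have "sorted (map h xs)" by (simp add: xs_def)
    then have "map h xs ! (j - 1) \<le> map h xs ! (i - 1)"
      by (rule sorted_nth_mono[OF _ le]) (use i in simp)
    then have "h (xs ! (j - 1)) \<le> h (xs ! (i - 1))"
      using i order.strict_trans1[OF le i] by (simp only: nth_map)
    then have "h (\<pi> j) \<le> h (\<pi> i)"
      using ij(1,2) by (simp only: \<pi>_def if_True)
    then show False using mono[OF ij(3)] by simp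
  qed
  ultimately show ?thesis by (auto simp: linear_extensions_def)
qed

text \<open>
  The chains themselves serve as labels, which turns comparability into equality of letters.
\<close>

lemma direct_sum_of_chains_labelling:
  assumes "partial_order_on {1..n} r" "direct_sum_of_chains n r"
  obtains ch :: "nat \<Rightarrow> nat set"
  where "\<And>x y. x \<in> {1..n} \<Longrightarrow> y \<in> {1..n} \<Longrightarrow> incomparable r x y \<longleftrightarrow> ch x \<noteq> ch y"
proof -
  have re: "refl_on {1..n} r"
    using assms(1) by (auto simp: partial_order_on_def preorder_on_def)
  obtain \<C> where part: "partition_on {1..n} \<C>" and total: "\<And>C. C \<in> \<C> \<Longrightarrow> total_on C r"
    and inc: "\<And>C D x y. C \<in> \<C> \<Longrightarrow> D \<in> \<C> \<Longrightarrow> C \<noteq> D \<Longrightarrow> x \<in> C \<Longrightarrow> y \<in> D \<Longrightarrow> incomparable r x y"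
    using assms(2) unfolding direct_sum_of_chains_def by metis
  have "\<forall>x\<in>{1..n}. \<exists>C. C \<in> \<C> \<and> x \<in> C"
    using partition_onD1[OF part] by blast
  then obtain ch where ch: "\<And>x. x \<in> {1..n} \<Longrightarrow> ch x \<in> \<C> \<and> x \<in> ch x"
    by metis
  have "incomparable r x y \<longleftrightarrow> ch x \<noteq> ch y" if "x \<in> {1..n}" "y \<in> {1..n}" for x y
  proof
    show "incomparable r x y" if "ch x \<noteq> ch y"
      using inc[of "ch x" "ch y"] ch \<open>x \<in> {1..n}\<close> \<open>y \<in> {1..n}\<close> that by blast
    show "ch x \<noteq> ch y" if "incomparable r x y"
    proof
      assume "ch x = ch y"
      then have "x \<in> ch x" "y \<in> ch x" "total_on (ch x) r"
        using ch \<open>x \<in> {1..n}\<close> \<open>y \<in> {1..n}\<close> total by auto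
      then show False
        using that refl_onD[OF re \<open>x \<in> {1..n}\<close>] by (cases "x = y") (auto simp: incomparable_def total_on_def)
    qed
  qed
  then show ?thesis by (rule that)
qed

locale chain_labelling =
  fixes n :: nat and r :: "nat rel" and ch :: "nat \<Rightarrow> 'c"
  assumes po: "partial_order_on {1..n} r"
    and incomparable_iff: "x \<in> {1..n} \<Longrightarrow> y \<in> {1..n} \<Longrightarrow> incomparable r x y \<longleftrightarrow> ch x \<noteq> ch y"
begin

lemma linear_extensionD:
  assumes "\<pi> \<in> linear_extensions n r"
  shows "\<pi> permutes {1..n}"
    and "i \<in> {1..n} \<Longrightarrow> j \<in> {1..n} \<Longrightarrow> strictly_below r (\<pi> i) (\<pi> j) \<Longrightarrow> i < j"
    and "i \<in> {1..n} \<Longrightarrow> \<pi> i \<in> {1..n}"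
  using assms permutes_in_image[of \<pi> "{1..n}" i] unfolding linear_extensions_def by blast+

lemma tau_linear_extension:
  assumes \<pi>: "\<pi> \<in> linear_extensions n r" and k: "1 \<le> k" "k < n"
  shows "tau r k \<pi> \<in> linear_extensions n r"
proof (cases "incomparable r (\<pi> k) (\<pi> (k + 1))")
  case True
  let ?s = "transpose k (k + 1)"
  have s: "?s permutes {1..n}" using k by (intro permutes_swap_id) auto
  have "\<pi> \<circ> ?s permutes {1..n}"
    by (rule permutes_compose[OF s linear_extensionD(1)[OF \<pi>]])
  moreover have "i < j" if ij: "i \<in> {1..n}" "j \<in> {1..n}" "strictly_below r ((\<pi> \<circ> ?s) i) ((\<pi> \<circ> ?s) j)" for i j
  proof -
    have "?s i < ?s j"
      by (rule linear_extensionD(2)[OF \<pi>]) (use ij permutes_in_image[OF s] in auto)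
    moreover have "\<not> (?s i = k \<and> ?s j = k + 1)"
      using True ij(3) by (auto simp: incomparable_def strictly_below_def)
    ultimately show ?thesis by (auto simp: transpose_def split: if_splits)
  qed
  ultimately show ?thesis using True by (simp add: tau_def linear_extensions_def)
qed (use \<pi> in \<open>simp add: tau_def\<close>)

text \<open>
  For comparable neighbours \<open>\<tau>\<close> does nothing, and neither does the exchange of two equal letters.
\<close>

lemma tau_word:
  assumes \<pi>: "\<pi> \<in> linear_extensions n r" and k: "1 \<le> k" "k < n"
  shows "ch \<circ> tau r k \<pi> = ch \<circ> \<pi> \<circ> transpose k (Suc k)"
proof (cases "incomparable r (\<pi> k) (\<pi> (k + 1))")
  case True
  then show ?thesis by (simp add: tau_def o_assoc)
next
  case False
  have "\<pi> k \<in> {1..n}" "\<pi> (k + 1) \<in> {1..n}"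
    using linear_extensionD(3)[OF \<pi>] k by auto
  then have "ch (\<pi> k) = ch (\<pi> (Suc k))" using False incomparable_iff by auto
  then show ?thesis using False by (auto simp: tau_def fun_eq_iff transpose_def)
qed

lemma fold_tau_up:
  assumes "i \<le> j" "1 \<le> i" "j \<le> n" and \<pi>: "\<pi> \<in> linear_extensions n r"
  shows "fold (tau r) [i..<j] \<pi> \<in> linear_extensions n r \<and>
    ch \<circ> fold (tau r) [i..<j] \<pi> = ch \<circ> \<pi> \<circ> cyc i j"
  using assms(1,3)
proof (induction j rule: dec_induct)
  case base
  then show ?case using \<pi> by simp
next
  case (step j)
  let ?\<rho> = "fold (tau r) [i..<j] \<pi>"
  have "?\<rho> \<in> linear_extensions n r \<and> ch \<circ> ?\<rho> = ch \<circ> \<pi> \<circ> cyc i j"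
    by (rule step.IH) (use step.prems in simp)
  then have IH: "?\<rho> \<in> linear_extensions n r" "ch \<circ> ?\<rho> = ch \<circ> \<pi> \<circ> cyc i j"
    by (rule conjunct1, rule conjunct2)
  have eq: "fold (tau r) [i..<Suc j] \<pi> = tau r j ?\<rho>" using step by simp
  have j: "1 \<le> j" "j < n" using step assms by auto
  have "ch \<circ> tau r j ?\<rho> = ch \<circ> \<pi> \<circ> cyc i (Suc j)"
    unfolding tau_word[OF IH(1) j] IH(2) cyc_Suc(1)[OF \<open>i \<le> j\<close>] by (simp only: o_assoc)
  then show ?case
    unfolding eq using tau_linear_extension[OF IH(1) j] by (intro conjI)
qed

lemma fold_tau_down:
  assumes "j \<le> i" "1 \<le> j" "i \<le> n" and "\<pi> \<in> linear_extensions n r"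
  shows "fold (tau r) (rev [j..<i]) \<pi> \<in> linear_extensions n r \<and>
    ch \<circ> fold (tau r) (rev [j..<i]) \<pi> = ch \<circ> \<pi> \<circ> cyc i j"
  using assms(1,3,4)
proof (induction i arbitrary: \<pi> rule: dec_induct)
  case base
  then show ?case by simp
next
  case (step i)
  have i: "1 \<le> i" "i < n" using step assms by auto
  have eq: "fold (tau r) (rev [j..<Suc i]) \<pi> = fold (tau r) (rev [j..<i]) (tau r i \<pi>)" using step by simp
  have L: "tau r i \<pi> \<in> linear_extensions n r" by (rule tau_linear_extension) (use i step in auto)
  have word: "ch \<circ> tau r i \<pi> \<circ> cyc i j = ch \<circ> \<pi> \<circ> cyc (Suc i) j"
    unfolding tau_word[OF step.prems(2) i] cyc_Suc(2)[OF \<open>j \<le> i\<close>] by (simp only: o_assoc)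
  show ?case
    unfolding eq word[symmetric] by (rule step.IH[OF less_imp_le[OF i(2)] L])
qed

lemma T_op_word:
  assumes "\<pi> \<in> linear_extensions n r" "i \<in> {1..n}" "j \<in> {1..n}"
  shows "T_op r i j \<pi> \<in> linear_extensions n r" "ch \<circ> T_op r i j \<pi> = ch \<circ> \<pi> \<circ> cyc i j"
  using fold_tau_up[of i j \<pi>] fold_tau_down[of j i \<pi>] assms unfolding T_op_def by auto

text \<open>
  At the first position where two linear extensions with the same word differ, their entries lie in one
  chain. The smaller of the two would have to occur in the other linear extension at an earlier
  position, where both agree.
\<close>

lemma word_inj:
  assumes \<pi>: "\<pi> \<in> linear_extensions n r" and \<rho>: "\<rho> \<in> linear_extensions n r"
    and eq: "ch \<circ> \<pi> = ch \<circ> \<rho>"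
  shows "\<pi> = \<rho>"
proof -
  have first: "\<not> strictly_below r (\<pi> i) (\<rho> i)"
    if i: "i \<in> {1..n}" and less: "\<And>j. j \<in> {1..n} \<Longrightarrow> j < i \<Longrightarrow> \<pi> j = \<rho> j"
      and \<pi>: "\<pi> \<in> linear_extensions n r" and \<rho>: "\<rho> \<in> linear_extensions n r" for \<pi> \<rho> i
  proof
    assume below: "strictly_below r (\<pi> i) (\<rho> i)"
    have "\<pi> i \<in> {1..n}" using linear_extensionD(3)[OF \<pi> i] .
    then have "\<pi> i \<in> \<rho> ` {1..n}" using permutes_image[OF linear_extensionD(1)[OF \<rho>]] by simp
    then obtain k where k: "k \<in> {1..n}" "\<rho> k = \<pi> i" by auto
    then have "k < i" using linear_extensionD(2)[OF \<rho> k(1) i] below by simp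
    then have "\<pi> k = \<pi> i" using less k by simp
    then show False
      using permutes_inj[OF linear_extensionD(1)[OF \<pi>]] \<open>k < i\<close> by (auto dest: injD)
  qed
  have "\<pi> i = \<rho> i" if "i \<in> {1..n}" for i
    using that
  proof (induction i rule: less_induct)
    case (less i)
    have "ch (\<pi> i) = ch (\<rho> i)" using fun_cong[OF eq, of i] by simp
    then have comparable: "\<not> incomparable r (\<pi> i) (\<rho> i)"
      using incomparable_iff linear_extensionD(3)[OF \<pi> less.prems] linear_extensionD(3)[OF \<rho> less.prems]
      by simp
    have same: "\<pi> j = \<rho> j" if "j \<in> {1..n}" "j < i" for j
      using less.IH that by blast
    have 1: "\<not> strictly_below r (\<pi> i) (\<rho> i)"
      by (rule first[OF less.prems same \<pi> \<rho>])
    have 2: "\<not> strictly_below r (\<rho> i) (\<pi> i)"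
      by (rule first[OF less.prems same[symmetric] \<rho> \<pi>])
    from 1 2 comparable show ?case
      unfolding incomparable_def strictly_below_def by argo
  qed
  moreover have "\<pi> i = \<rho> i" if "i \<notin> {1..n}" for i
    using that permutes_not_in[OF linear_extensionD(1)[OF \<pi>]] permutes_not_in[OF linear_extensionD(1)[OF \<rho>]]
    by simp
  ultimately show ?thesis by blast
qed

definition words :: "(nat \<Rightarrow> 'c) set" where
  "words = (\<lambda>\<pi>. ch \<circ> \<pi>) ` linear_extensions n r"

lemma words_adjacent:
  assumes "w \<in> words" and k: "1 \<le> k" "k < n"
  shows "w \<circ> transpose k (Suc k) \<in> words"
proof -
  obtain \<pi> where \<pi>: "\<pi> \<in> linear_extensions n r" "w = ch \<circ> \<pi>"
    using assms(1) by (auto simp: words_def)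
  show ?thesis
    unfolding words_def \<pi>(2) tau_word[OF \<pi>(1) k, symmetric]
    by (rule imageI) (rule tau_linear_extension[OF \<pi>(1) k])
qed

lemma finite_linear_extensions: "finite (linear_extensions n r)"
  by (rule finite_subset[OF _ finite_permutations[of "{1..n}"]]) (auto simp: linear_extensions_def)

sublocale word_space words n
proof
  show "finite words" unfolding words_def using finite_linear_extensions by simp
  show "w \<circ> \<sigma> \<in> words" if "w \<in> words" "\<sigma> permutes {1..n}" for w \<sigma>
    by (rule adjacent_transpositions_generate[OF words_adjacent that(2,1)])
qed

lemma words_transitive:
  assumes "u \<in> words" "v \<in> words"
  shows "\<exists>\<sigma>. \<sigma> permutes {1..n} \<and> v = u \<circ> \<sigma>"
proof -
  obtain \<pi> \<rho> where \<pi>: "\<pi> \<in> linear_extensions n r" "u = ch \<circ> \<pi>" and \<rho>: "\<rho> \<in> linear_extensions n r" "v = ch \<circ> \<rho>"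
    using assms by (auto simp: words_def)
  note p = linear_extensionD(1)[OF \<pi>(1)] linear_extensionD(1)[OF \<rho>(1)]
  have "inv_into UNIV \<pi> \<circ> \<rho> permutes {1..n}" by (rule permutes_compose[OF p(2) permutes_inv[OF p(1)]])
  moreover have "v = u \<circ> (inv_into UNIV \<pi> \<circ> \<rho>)"
    using permutes_inverses(1)[OF p(1)] by (simp add: \<pi> \<rho> fun_eq_iff)
  ultimately show ?thesis by blast
qed

text \<open>
  The cover relations stay within a chain, and so does every undirected path.
\<close>

lemma disconnected:
  assumes xy: "x \<in> {1..n}" "y \<in> {1..n}" "ch x \<noteq> ch y"
  shows "disconnected_poset n r"
  unfolding disconnected_poset_def
proof
  let ?G = "mk_symmetric (with_proj (hasse_diagram n r))"
  assume "Digraph_Component.connected (with_proj (hasse_diagram n r))"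
  then have "(x, y) \<in> rtrancl_on (pverts ?G) (parcs ?G)"
    using xy by (auto simp: Digraph_Component.connected_def strongly_connected_def reachable_def hasse_diagram_def)
  moreover have same: "ch a = ch b" if "(a, b) \<in> parcs ?G" for a b
  proof -
    from that have "a \<in> {1..n}" "b \<in> {1..n}" "\<not> incomparable r a b"
      by (auto simp: parcs_mk_symmetric hasse_diagram_def strictly_below_def incomparable_def)
    then show ?thesis using incomparable_iff by blast
  qed
  ultimately have "ch x = ch y"
    by (induction rule: rtrancl_on_induct) auto
  then show False using xy by simp
qed

text \<open>
  This identifies the transition matrix with the random-to-random operator on words, scaled by
  \<open>1 / n\<^sup>2\<close>.
\<close>

lemma sum_rtr_prob:
  assumes \<pi>: "\<pi> \<in> linear_extensions n r"
  shows "(\<Sum>\<rho>\<in>linear_extensions n r. rtr_prob n r \<pi> \<rho> * g (ch \<circ> \<rho>))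
    = random_to_random n g (ch \<circ> \<pi>) / (real n)\<^sup>2"
proof -
  let ?L = "linear_extensions n r" and ?S = "{1..n} \<times> {1..n}"
  let ?T = "\<lambda>p. T_op r (fst p) (snd p) \<pi>"
  have card: "real (card {(i, j). i \<in> {1..n} \<and> j \<in> {1..n} \<and> \<rho> = T_op r i j \<pi>})
      = (\<Sum>p\<in>?S. if ?T p = \<rho> then 1 else 0)" for \<rho>
  proof -
    have "{(i, j). i \<in> {1..n} \<and> j \<in> {1..n} \<and> \<rho> = T_op r i j \<pi>} = {p \<in> ?S. ?T p = \<rho>}"
      by auto
    then show ?thesis by (simp add: sum.inter_filter[symmetric])
  qed
  have pull: "(\<Sum>p\<in>?S. if ?T p = \<rho> then 1 else 0) * g (ch \<circ> \<rho>)
      = (\<Sum>p\<in>?S. if ?T p = \<rho> then g (ch \<circ> \<rho>) else 0)" for \<rho>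
    unfolding sum_distrib_right by (intro sum.cong refl) simp
  have "(\<Sum>\<rho>\<in>?L. rtr_prob n r \<pi> \<rho> * g (ch \<circ> \<rho>))
      = (\<Sum>\<rho>\<in>?L. \<Sum>p\<in>?S. if ?T p = \<rho> then g (ch \<circ> \<rho>) else 0) / (real n)\<^sup>2"
    unfolding rtr_prob_def card times_divide_eq_left pull
    by (rule sum_divide_distrib[symmetric])
  also have "(\<Sum>\<rho>\<in>?L. \<Sum>p\<in>?S. if ?T p = \<rho> then g (ch \<circ> \<rho>) else 0)
      = (\<Sum>p\<in>?S. \<Sum>\<rho>\<in>?L. if ?T p = \<rho> then g (ch \<circ> \<rho>) else 0)"
    by (rule sum.swap)
  also have "\<dots> = (\<Sum>p\<in>?S. g (ch \<circ> \<pi> \<circ> cyc (fst p) (snd p)))"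
  proof (intro sum.cong refl)
    fix p assume "p \<in> ?S"
    then have "?T p \<in> ?L" "ch \<circ> ?T p = ch \<circ> \<pi> \<circ> cyc (fst p) (snd p)"
      using T_op_word[OF \<pi>] by auto
    then show "(\<Sum>\<rho>\<in>?L. if ?T p = \<rho> then g (ch \<circ> \<rho>) else 0) = g (ch \<circ> \<pi> \<circ> cyc (fst p) (snd p))"
      using finite_linear_extensions by (simp add: sum.delta)
  qed
  also have "\<dots> = random_to_random n g (ch \<circ> \<pi>)"
    unfolding random_to_random_def sum.cartesian_product by (simp add: case_prod_beta)
  finally show ?thesis .
qed

end

section \<open>The transition matrix\<close>

locale enumerated_chain_labelling = chain_labelling n r ch
  for n r and ch :: "nat \<Rightarrow> 'c" +
  fixes ls :: "(nat \<Rightarrow> nat) list"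
  assumes distinct_ls: "distinct ls" and set_ls: "set ls = linear_extensions n r"
    and n_pos: "1 \<le> n"
begin

definition word :: "nat \<Rightarrow> nat \<Rightarrow> 'c" where
  "word a = ch \<circ> ls ! a"

text \<open>
  Vectors are indexed by the enumeration of the linear extensions; by injectivity of the word map
  they correspond to functions on words, extended by zero.
\<close>

definition lift :: "real vec \<Rightarrow> (nat \<Rightarrow> 'c) \<Rightarrow> real" where
  "lift v w = (if w \<in> words then v $ (THE a. a < length ls \<and> word a = w) else 0)"

lemma ls_in: "a < length ls \<Longrightarrow> ls ! a \<in> linear_extensions n r"
  using set_ls nth_mem by blast

lemma word_in: "a < length ls \<Longrightarrow> word a \<in> words"
  using ls_in by (auto simp: word_def words_def)

lemma word_surj: "w \<in> words \<Longrightarrow> \<exists>a<length ls. w = word a"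
  unfolding words_def word_def set_ls[symmetric] by (auto simp: in_set_conv_nth)

lemma word_eq_iff: "a < length ls \<Longrightarrow> b < length ls \<Longrightarrow> word a = word b \<longleftrightarrow> a = b"
  using word_inj[OF ls_in ls_in] nth_eq_iff_index_eq[OF distinct_ls] by (auto simp: word_def)

lemma lift_word: "a < length ls \<Longrightarrow> lift v (word a) = v $ a"
proof -
  assume a: "a < length ls"
  then have "(THE b. b < length ls \<and> word b = word a) = a"
    using word_eq_iff by (intro the_equality) auto
  then show ?thesis using a by (simp add: lift_def word_in)
qed

lemma supported_lift: "supported (lift v)"
  by (simp add: supported_def lift_def)

lemma matrix_carrier: "rtr_matrix n r ls \<in> carrier_mat (length ls) (length ls)"
  by (simp add: rtr_matrix_def)

lemma matrix_row_sum:
  assumes a: "a < length ls"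
  shows "(\<Sum>b<length ls. rtr_matrix n r ls $$ (a, b) * g (word b))
    = random_to_random n g (word a) / (real n)\<^sup>2"
proof -
  have bij: "bij_betw ((!) ls) {..<length ls} (linear_extensions n r)"
    using bij_betw_nth[OF distinct_ls] set_ls by auto
  have "(\<Sum>b<length ls. rtr_matrix n r ls $$ (a, b) * g (word b))
      = (\<Sum>b<length ls. rtr_prob n r (ls ! a) (ls ! b) * g (ch \<circ> ls ! b))"
    using a by (intro sum.cong refl) (simp add: rtr_matrix_def word_def)
  also have "\<dots> = (\<Sum>\<rho>\<in>linear_extensions n r. rtr_prob n r (ls ! a) \<rho> * g (ch \<circ> \<rho>))"
    by (rule sum.reindex_bij_betw[OF bij])
  finally show ?thesis using sum_rtr_prob[OF ls_in[OF a], of g] by (simp add: word_def)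
qed

lemma matrix_mult_vec:
  assumes v: "v \<in> carrier_vec (length ls)" and g: "\<And>b. b < length ls \<Longrightarrow> g (word b) = v $ b"
    and a: "a < length ls"
  shows "(rtr_matrix n r ls *\<^sub>v v) $ a = random_to_random n g (word a) / (real n)\<^sup>2"
proof -
  have "(rtr_matrix n r ls *\<^sub>v v) $ a = (\<Sum>b<length ls. rtr_matrix n r ls $$ (a, b) * g (word b))"
    using a v matrix_carrier g by (simp add: scalar_prod_def atLeast0LessThan)
  then show ?thesis using matrix_row_sum[OF a] by simp
qed

lemma lift_eigenvector:
  assumes v: "v \<in> carrier_vec (length ls)"
    and eq: "\<And>a. a < length ls \<Longrightarrow> (rtr_matrix n r ls *\<^sub>v v) $ a = \<mu> * v $ a + c"
    and w: "w \<in> words"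
  shows "random_to_random n (lift v) w = (real n)\<^sup>2 * \<mu> * lift v w + (real n)\<^sup>2 * c"
proof -
  obtain a where a: "a < length ls" "w = word a" using word_surj[OF w] by blast
  have "random_to_random n (lift v) (word a) / (real n)\<^sup>2 = \<mu> * v $ a + c"
    using matrix_mult_vec[OF v lift_word a(1)] eq[OF a(1)] by simp
  then show ?thesis
    using n_pos a by (simp add: lift_word field_simps)
qed

lemma eigenvalue_nonneg:
  assumes "eigenvalue (rtr_matrix n r ls) \<mu>"
  shows "0 \<le> \<mu>"
proof -
  obtain v where v: "v \<in> carrier_vec (length ls)" "v \<noteq> 0\<^sub>v (length ls)"
      and eq: "rtr_matrix n r ls *\<^sub>v v = \<mu> \<cdot>\<^sub>v v"
    using assms matrix_carrier unfolding eigenvalue_def eigenvector_def by auto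
  have R: "random_to_random n (lift v) = (\<lambda>w. ((real n)\<^sup>2 * \<mu>) * lift v w)"
  proof
    fix w
    show "random_to_random n (lift v) w = ((real n)\<^sup>2 * \<mu>) * lift v w"
    proof (cases "w \<in> words")
      case True
      then show ?thesis using lift_eigenvector[OF v(1), of \<mu> 0 w] eq v(1) by simp
    next
      case False
      then show ?thesis
        using supported_lift supported_random_to_random[OF supported_lift] by (simp add: supported_def)
    qed
  qed
  obtain a where a: "a < length ls" "v $ a \<noteq> 0"
    using v by (metis eq_vecI carrier_vecD index_zero_vec)
  then have "lift v \<noteq> (\<lambda>_. 0)" using lift_word[OF a(1), of v] by metis
  from random_to_random_eigenvalue_nonneg[OF supported_lift this R]
  show ?thesis using n_pos by (simp add: zero_le_mult_iff)
qed

lemma gap_bound_normalized: "(real n + 1) * (real n - 2) / (real n)\<^sup>2 = (1 + 1 / real n) * (1 - 2 / real n)"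
  using n_pos by (simp add: field_simps power2_eq_square)

lemma eigenvalue_attained:
  assumes xy: "x \<in> {1..n}" "y \<in> {1..n}" "ch x \<noteq> ch y"
  shows "eigenvalue (rtr_matrix n r ls) ((1 + 1 / real n) * (1 - 2 / real n))"
proof -
  let ?f = "letter_position n (ch x)"
  obtain \<pi> where \<pi>: "\<pi> \<in> linear_extensions n r" using linear_extension_exists[OF po] by blast
  let ?w = "ch \<circ> \<pi>"
  note image = permutes_image[OF linear_extensionD(1)[OF \<pi>]]
  obtain p where p: "p \<in> {1..n}" "\<pi> p = x" using image xy(1) by (metis imageE)
  obtain q where q: "q \<in> {1..n}" "\<pi> q = y" using image xy(2) by (metis imageE)
  have w: "?w \<in> words" using \<pi> by (auto simp: words_def)
  have w': "?w \<circ> transpose p q \<in> words" by (rule closed_X[OF w permutes_swap_id[OF p(1) q(1)]])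
  have "?f (?w \<circ> transpose p q) = ?f ?w + (real q - real p)"
    using p q xy by (intro letter_position_transpose) auto
  moreover have "p \<noteq> q" using p q xy by auto
  ultimately have "?f (?w \<circ> transpose p q) \<noteq> 0 \<or> ?f ?w \<noteq> 0" by auto
  then obtain u where "u \<in> words" "?f u \<noteq> 0" using w w' by blast
  then obtain a where a: "a < length ls" "?f (word a) \<noteq> 0" using word_surj by blast
  define v where "v = vec (length ls) (\<lambda>b. ?f (word b))"
  have v: "v \<in> carrier_vec (length ls)" by (simp add: v_def)
  have "rtr_matrix n r ls *\<^sub>v v = ((1 + 1 / real n) * (1 - 2 / real n)) \<cdot>\<^sub>v v"
  proof (rule eq_vecI)
    fix b assume "b < dim_vec (((1 + 1 / real n) * (1 - 2 / real n)) \<cdot>\<^sub>v v)"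
    then have b: "b < length ls" by (simp add: v_def)
    have "(rtr_matrix n r ls *\<^sub>v v) $ b = random_to_random n ?f (word b) / (real n)\<^sup>2"
      by (rule matrix_mult_vec[OF v _ b]) (simp add: v_def)
    also have "\<dots> = (1 + 1 / real n) * (1 - 2 / real n) * ?f (word b)"
      unfolding random_to_random_letter_position gap_bound_normalized[symmetric] by simp
    finally show "(rtr_matrix n r ls *\<^sub>v v) $ b = (((1 + 1 / real n) * (1 - 2 / real n)) \<cdot>\<^sub>v v) $ b"
      using b by (simp add: v_def)
  qed (simp add: v_def rtr_matrix_def)
  moreover have "v \<noteq> 0\<^sub>v (length ls)" using a by (auto simp: v_def vec_eq_iff)
  ultimately show ?thesis
    using v matrix_carrier unfolding eigenvalue_def eigenvector_def by auto
qed

lemma gap_modulo_constants: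
  assumes v: "v \<in> carrier_vec (length ls)"
    and eq: "\<And>a. a < length ls \<Longrightarrow> (rtr_matrix n r ls *\<^sub>v v) $ a = \<mu> * v $ a + c"
    and a: "a < length ls" "b < length ls" "v $ a \<noteq> v $ b"
  shows "\<mu> \<le> (1 + 1 / real n) * (1 - 2 / real n)"
proof -
  have "(real n)\<^sup>2 * \<mu> \<le> (real n)\<^sup>2 - real n - 2"
  proof (rule random_to_random_gap_modulo_constants[OF words_transitive n_pos, of "lift v"])
    show "word a \<in> words" "word b \<in> words" "lift v (word a) \<noteq> lift v (word b)"
      using a by (simp_all add: word_in lift_word)
  qed (use lift_eigenvector[OF v eq] in auto)
  also have "(real n)\<^sup>2 - real n - 2 = (real n + 1) * (real n - 2)"
    by (simp add: power2_eq_square algebra_simps)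
  finally show ?thesis
    using n_pos unfolding gap_bound_normalized[symmetric] by (simp add: field_simps)
qed

text \<open>
  The characteristic polynomial of the matrix is \<open>X - 1\<close> times that of the matrix induced on the quotient by
  the constants. An eigenvector of the latter, extended by a first coordinate zero, satisfies the
  eigenvector equation up to a constant, so all its eigenvalues are at most the bound, which is less
  than \<open>1\<close>. The bound itself is an eigenvalue, so it is the second entry of the sorted list of roots.
\<close>

lemma second_largest_eigenvalue:
  assumes xy: "x \<in> {1..n}" "y \<in> {1..n}" "ch x \<noteq> ch y"
  shows "second_largest_eigenvalue (rtr_matrix n r ls) = (1 + 1 / real n) * (1 - 2 / real n)"
proof -
  let ?A = "rtr_matrix n r ls" and ?l = "(1 + 1 / real n) * (1 - 2 / real n)"
  have "ls \<noteq> []" using linear_extension_exists[OF po] set_ls by auto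
  then obtain m where m: "length ls = Suc m" by (cases ls) auto
  have A: "?A \<in> carrier_mat (Suc m) (Suc m)" using matrix_carrier m by simp
  have rows: "(\<Sum>b<Suc m. ?A $$ (a, b)) = 1" if "a < Suc m" for a
    using matrix_row_sum[of a "\<lambda>_. 1"] that m n_pos
    by (simp add: random_to_random_def power2_eq_square)
  define B where "B = mat m m (\<lambda>(i, j). ?A $$ (Suc i, Suc j) - ?A $$ (0, Suc j))"
  have B: "B \<in> carrier_mat m m" by (simp add: B_def)
  have cp: "char_poly ?A = [:-1, 1:] * char_poly B"
    unfolding B_def by (rule char_poly_constant_row_sums[OF A rows])
  have l1: "?l < 1" using n_pos by (simp add: field_simps)
  have B0: "char_poly B \<noteq> 0"
    using degree_monic_char_poly[OF B] by auto
  have le: "\<mu> \<le> ?l" if root: "poly (char_poly B) \<mu> = 0" for \<mu>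
  proof -
    have "eigenvalue B \<mu>" using eigenvalue_root_char_poly[OF B] root by simp
    then obtain w where w: "w \<in> carrier_vec m" "w \<noteq> 0\<^sub>v m" "B *\<^sub>v w = \<mu> \<cdot>\<^sub>v w"
      using B unfolding eigenvalue_def eigenvector_def by auto
    define v where "v = vec (Suc m) (\<lambda>i. case i of 0 \<Rightarrow> 0 | Suc j \<Rightarrow> w $ j)"
    define c where "c = (\<Sum>j<m. ?A $$ (0, Suc j) * w $ j)"
    have Av: "(?A *\<^sub>v v) $ i = (\<Sum>j<m. ?A $$ (i, Suc j) * w $ j)" if "i < Suc m" for i
    proof -
      have "(?A *\<^sub>v v) $ i = (\<Sum>j<Suc m. ?A $$ (i, j) * v $ j)"
        using that A by (simp add: scalar_prod_def atLeast0LessThan v_def)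
      also have "\<dots> = (\<Sum>j<m. ?A $$ (i, Suc j) * w $ j)"
        unfolding sum.lessThan_Suc_shift by (simp add: v_def)
      finally show ?thesis .
    qed
    have eq: "(?A *\<^sub>v v) $ i = \<mu> * v $ i + c" if i: "i < length ls" for i
    proof (cases i)
      case 0
      then show ?thesis using Av[of 0] by (simp add: v_def c_def)
    next
      case (Suc k)
      then have k: "k < m" using i m by simp
      have "\<mu> * w $ k = (\<mu> \<cdot>\<^sub>v w) $ k" using w(1) k by simp
      also have "\<dots> = (B *\<^sub>v w) $ k" by (simp only: w(3))
      also have "\<dots> = (\<Sum>j<m. (?A $$ (Suc k, Suc j) - ?A $$ (0, Suc j)) * w $ j)"
        using k w(1) by (simp add: scalar_prod_def atLeast0LessThan B_def)
      also have "\<dots> = (?A *\<^sub>v v) $ i - c"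
        using k Suc by (simp add: Av c_def sum_subtractf left_diff_distrib)
      finally show ?thesis using Suc k by (simp add: v_def)
    qed
    obtain k where k: "k < m" "w $ k \<noteq> 0"
      using w by (metis eq_vecI carrier_vecD index_zero_vec)
    show ?thesis
      by (rule gap_modulo_constants[OF _ eq, of "Suc k" 0]) (use k m in \<open>auto simp: v_def\<close>)
  qed
  have "poly (char_poly ?A) ?l = 0"
    using eigenvalue_attained[OF xy] eigenvalue_root_char_poly[OF A] by simp
  then have "poly (char_poly B) ?l = 0" using l1 unfolding cp by auto
  then have "?l \<in># proots (char_poly B)" using B0 by simp
  then obtain M where M: "proots (char_poly B) = add_mset ?l M" by (metis mset_add)
  have "x \<le> ?l" if "x \<in># M" for x
  proof -
    have "x \<in># proots (char_poly B)" using that M by simp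
    then show ?thesis using le B0 by simp
  qed
  then have "sorted_list_of_multiset (add_mset 1 (add_mset ?l M)) = sorted_list_of_multiset M @ [?l, 1]"
    by (rule sorted_list_of_multiset_two_largest) (use l1 in auto)
  moreover have "proots (char_poly ?A) = add_mset 1 (add_mset ?l M)"
    unfolding cp using B0 M by (subst proots_mult) auto
  ultimately show ?thesis by (simp add: second_largest_eigenvalue_def)
qed

end

theorem proposition3p1:
  fixes n :: nat and r :: "nat rel" and ls :: "(nat \<Rightarrow> nat) list"
  assumes "partial_order_on {1..n} r"
    and "nontrivial_poset n r"
    and "direct_sum_of_chains n r"
    and "distinct ls" and "set ls = linear_extensions n r"
  shows "second_largest_eigenvalue (rtr_matrix n r ls) \<le> (1 + 1 / real n) * (1 - 2 / real n) \<and>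
    (second_largest_eigenvalue (rtr_matrix n r ls) = (1 + 1 / real n) * (1 - 2 / real n)
       \<longleftrightarrow> disconnected_poset n r) \<and>
    (\<forall>\<mu>. eigenvalue (rtr_matrix n r ls) \<mu> \<longrightarrow> 0 \<le> \<mu>)"
proof -
  obtain ch :: "nat \<Rightarrow> nat set" where
    ch: "\<And>x y. x \<in> {1..n} \<Longrightarrow> y \<in> {1..n} \<Longrightarrow> incomparable r x y \<longleftrightarrow> ch x \<noteq> ch y"
    using direct_sum_of_chains_labelling[OF assms(1,3)] by blast
  obtain x y where xy: "x \<in> {1..n}" "y \<in> {1..n}" "incomparable r x y"
    using assms(2) by (auto simp: nontrivial_poset_def total_on_def incomparable_def)
  then have "ch x \<noteq> ch y" using ch by blast
  interpret enumerated_chain_labelling n r ch ls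
    by unfold_locales (use assms ch xy in auto)
  show ?thesis
    using second_largest_eigenvalue[OF xy(1,2)] disconnected[OF xy(1,2)] eigenvalue_nonneg \<open>ch x \<noteq> ch y\<close>
    by auto
qed

end
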